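(* Let $M$ be a compact manifold, $I=[0,T]$, and let $g(t)$, $t\in I$, be a Ricci flow on $M$, i.e. $\partial g/\partial t=-2\,{\rm Ric}_{g}$. Let $\hat g=g(t)+dt^2$ be the metric on $M\times I$ which is the orthogonal sum of the family $g(t)$ in the horizontal directions and the usual metric on $I$. Let $c\colon S^1\times I\to M$ be a smooth family of immersed curves satisfying the curve-shrinking equation $\partial c/\partial t=H$, where $S$ is the $g(t)$-unit tangent field, $H=\nabla^g_SS$ is the curvature vector, $k=|H|$, and let $\hat c(x,t)=(c(x,t),t)$, $X=\hat c_*(\partial_x)$, $\widehat H=\hat c_*(\partial_t)=H+\partial_t$. Let $s$ denote an arc-length parameter along the curves and let $'$ denote differentiation with respect to $s$. Then $$\begin{aligned} \frac{\partial}{\partial t}k^2 = {}& (k^2)''-2\langle(\nabla_SH)^\perp,(\nabla_SH)^\perp\rangle+2k^4\\ &-2\,{\rm Ric}_g(H,H)+4k^2\,{\rm Ric}_g(S,S)+2\,\widehat{Rm}(\widehat H,S,H,S)\\ &+2\,{\rm Ric}_g(S,S)\,{\rm Ric}_g(H,H)-2\,(\nabla^g_S({\rm Ric}_g))(S,H), \end{aligned}$$ where $\nabla$ is the Levi-Civita connection of $\hat g$, $\widehat{Rm}$ is the Riemannian curvature tensor of $\hat g$, and the superscript $\perp$ means the component orthogonal to $X$.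
   Context: Horizontal directions in $M\times I$ are those tangent to $M$; the vertical direction is spanned by $\partial_t$ (the coordinate field of $I$). $\nabla^g$ denotes the family of Levi-Civita connections of the metrics $g(t)$, applied to horizontal vector fields on each slice; ${\rm Ric}_g$ is the Ricci tensor of $g(t)$. All inner products are taken with respect to $\hat g$ (on horizontal vectors this is $g(t)$). Vector fields $X$, $\widehat H$, $H$, $S=X/|X|$ are regarded as vector fields along the immersion $\hat c\colon S^1\times I\to M\times I$; $X$, $S$ and $H$ are horizontal, and $\nabla_S$, $\nabla_{\widehat H}$ denote covariant differentiation (for $\hat g$) of vector fields along $\hat c$ in the indicated directions tangent to the image of $\hat c$. Orthogonality to $X$ in $(\cdot)^\perp$ is orthogonality in $T(M\times I)$ with respect to $\hat g$. The derivative $\partial/\partial t$ is taken at fixed $x\in S^1$, and for a function $f$ on $S^1\times I$, $f'=S(f)=|X|^{-1}\partial_x f$. Curvature convention: $\widehat{Rm}(A,B,C,D)=\langle \nabla_A\nabla_BD-\nabla_B\nabla_AD-\nabla_{[A,B]}D,\;C\rangle$. *)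

theory Defs
  imports "HOL-Analysis.Analysis"
begin

section \<open>Smooth maps\<close>

fun Ck_on :: "nat \<Rightarrow> 'a set \<Rightarrow> ('a::real_normed_vector \<Rightarrow> 'b::real_normed_vector) \<Rightarrow> bool" where
  "Ck_on 0 U f \<longleftrightarrow> continuous_on U f"
| "Ck_on (Suc k) U f \<longleftrightarrow> (\<forall>p\<in>U. f differentiable (at p)) \<and>
     (\<forall>v. Ck_on k U (\<lambda>p. frechet_derivative f (at p) v))"

text \<open>On an arbitrary set (in particular one with boundary, such as \<open>V \<times> {0..T}\<close>) smoothness means
  that there are local smooth extensions to open subsets of the ambient space.\<close>

definition smooth_on :: "'a set \<Rightarrow> ('a::real_normed_vector \<Rightarrow> 'b::real_normed_vector) \<Rightarrow> bool" where
  "smooth_on D f \<longleftrightarrow> (\<forall>p\<in>D. \<exists>U h. open U \<and> p \<in> U \<and> (\<forall>k. Ck_on k U h) \<and> (\<forall>q\<in>U \<inter> D. h q = f q))"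


section \<open>Riemannian geometry on a subset of a Euclidean space\<close>

text \<open>A metric on \<open>W\<close> is given by the inner products \<open>G p\<close> on the model space, \<open>p \<in> W\<close>; vector fields
  are identified with functions into the model space. Derivatives are taken within \<open>W\<close>, so that
  \<open>W\<close> may be the coordinate image of a chart with boundary.\<close>

definition dderiv ::
  "'a set \<Rightarrow> ('a::real_normed_vector \<Rightarrow> 'b::real_normed_vector) \<Rightarrow> 'a \<Rightarrow> 'a \<Rightarrow> 'b" where
  "dderiv W f p v = frechet_derivative f (at p within W) v"

text \<open>The Christoffel map \<open>\<Gamma>\<^sub>p\<close> of the Levi-Civita connection, i.e. \<open>\<Gamma>\<^sub>p(u,v) = \<nabla>\<^sub>u v\<close> for the constant
  (coordinate) field \<open>v\<close>. Symmetry is vanishing torsion, the last clause is compatibility with the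
  metric. (Existence and uniqueness are the fundamental theorem of Riemannian geometry.)\<close>

definition christoffel ::
  "'a set \<Rightarrow> ('a::euclidean_space \<Rightarrow> 'a \<Rightarrow> 'a \<Rightarrow> real) \<Rightarrow> 'a \<Rightarrow> 'a \<Rightarrow> 'a \<Rightarrow> 'a" where
  "christoffel W G p = (THE \<Gamma>. bilinear \<Gamma> \<and> (\<forall>u v. \<Gamma> u v = \<Gamma> v u) \<and>
     (\<forall>u v w. dderiv W (\<lambda>q. G q v w) p u = G p (\<Gamma> u v) w + G p v (\<Gamma> u w)))"

definition cov_deriv ::
  "'a set \<Rightarrow> ('a::euclidean_space \<Rightarrow> 'a \<Rightarrow> 'a \<Rightarrow> real) \<Rightarrow> ('a \<Rightarrow> 'a) \<Rightarrow> ('a \<Rightarrow> 'a) \<Rightarrow> 'a \<Rightarrow> 'a" where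
  "cov_deriv W G A B p = dderiv W B p (A p) + christoffel W G p (A p) (B p)"

definition lie_bracket ::
  "'a set \<Rightarrow> ('a::euclidean_space \<Rightarrow> 'a) \<Rightarrow> ('a \<Rightarrow> 'a) \<Rightarrow> 'a \<Rightarrow> 'a" where
  "lie_bracket W A B p = dderiv W B p (A p) - dderiv W A p (B p)"

definition curv_op ::
  "'a set \<Rightarrow> ('a::euclidean_space \<Rightarrow> 'a \<Rightarrow> 'a \<Rightarrow> real) \<Rightarrow>
   ('a \<Rightarrow> 'a) \<Rightarrow> ('a \<Rightarrow> 'a) \<Rightarrow> ('a \<Rightarrow> 'a) \<Rightarrow> 'a \<Rightarrow> 'a" where
  "curv_op W G A B D p =
     cov_deriv W G A (cov_deriv W G B D) p - cov_deriv W G B (cov_deriv W G A D) p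
     - cov_deriv W G (lie_bracket W A B) D p"

text \<open>\<open>Rm(a,b,c,d) = \<langle>\<nabla>\<^sub>A\<nabla>\<^sub>B D - \<nabla>\<^sub>B\<nabla>\<^sub>A D - \<nabla>\<^bsub>[A,B]\<^esub> D, c\<rangle>\<close>; being tensorial, it is evaluated on the constant
  extensions of the vectors. The Ricci tensor is the trace \<open>Ric(b,d) = tr (a \<mapsto> R(a,b)d)\<close>,
  which is positive on round spheres. The trace of an endomorphism does not involve the metric,
  so the standard basis of the model space can be used.\<close>

definition Rm ::
  "'a set \<Rightarrow> ('a::euclidean_space \<Rightarrow> 'a \<Rightarrow> 'a \<Rightarrow> real) \<Rightarrow> 'a \<Rightarrow> 'a \<Rightarrow> 'a \<Rightarrow> 'a \<Rightarrow> 'a \<Rightarrow> real" where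
  "Rm W G p a b c d = G p (curv_op W G (\<lambda>_. a) (\<lambda>_. b) (\<lambda>_. d) p) c"

definition Ric ::
  "'a set \<Rightarrow> ('a::euclidean_space \<Rightarrow> 'a \<Rightarrow> 'a \<Rightarrow> real) \<Rightarrow> 'a \<Rightarrow> 'a \<Rightarrow> 'a \<Rightarrow> real" where
  "Ric W G p b d = (\<Sum>e\<in>Basis. curv_op W G (\<lambda>_. e) (\<lambda>_. b) (\<lambda>_. d) p \<bullet> e)"

text \<open>\<open>(\<nabla>\<^sub>u F)(v,w)\<close> for a covariant 2-tensor field \<open>F\<close>, by the Leibniz rule on constant extensions.\<close>

definition cov_deriv2 ::
  "'a set \<Rightarrow> ('a::euclidean_space \<Rightarrow> 'a \<Rightarrow> 'a \<Rightarrow> real) \<Rightarrow> ('a \<Rightarrow> 'a \<Rightarrow> 'a \<Rightarrow> real) \<Rightarrow>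
   'a \<Rightarrow> 'a \<Rightarrow> 'a \<Rightarrow> 'a \<Rightarrow> real" where
  "cov_deriv2 W G F p u v w = dderiv W (\<lambda>q. F q v w) p u
     - F p (christoffel W G p u v) w - F p v (christoffel W G p u w)"

text \<open>Covariant derivative \<open>\<nabla>\<^bsub>d\<gamma>/d\<xi>\<^esub> V\<close> of a vector field \<open>V\<close> along a curve \<open>\<gamma>\<close>.\<close>

definition cov_along ::
  "'a set \<Rightarrow> ('a::euclidean_space \<Rightarrow> 'a \<Rightarrow> 'a \<Rightarrow> real) \<Rightarrow> (real \<Rightarrow> 'a) \<Rightarrow> (real \<Rightarrow> 'a) \<Rightarrow> real \<Rightarrow> 'a" where
  "cov_along W G \<gamma> V \<xi> = vector_derivative V (at \<xi>)
     + christoffel W G (\<gamma> \<xi>) (vector_derivative \<gamma> (at \<xi>)) (V \<xi>)"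

definition perp :: "('a::euclidean_space \<Rightarrow> 'a \<Rightarrow> real) \<Rightarrow> 'a \<Rightarrow> 'a \<Rightarrow> 'a" where
  "perp B X V = V - (B V X / B X X) *\<^sub>R X"


section \<open>Manifolds and time-dependent metrics\<close>

text \<open>A chart is a pair of its domain and its coordinate map.\<close>

type_synonym ('m, 'n) chart = "'m set \<times> ('m \<Rightarrow> real ^ 'n)"

definition chart_image :: "('m, 'n::finite) chart \<Rightarrow> (real ^ 'n) set" where
  "chart_image \<kappa> = snd \<kappa> ` fst \<kappa>"

definition transition :: "('m, 'n::finite) chart \<Rightarrow> ('m, 'n) chart \<Rightarrow> real ^ 'n \<Rightarrow> real ^ 'n" where
  "transition \<kappa> \<kappa>' y = snd \<kappa>' (inv_into (fst \<kappa>) (snd \<kappa>) y)"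

definition smooth_atlas :: "'m topology \<Rightarrow> ('m, 'n::finite) chart set \<Rightarrow> bool" where
  "smooth_atlas M \<A> \<longleftrightarrow>
     (\<forall>\<kappa>\<in>\<A>. openin M (fst \<kappa>) \<and> open (chart_image \<kappa>) \<and>
        homeomorphic_map (subtopology M (fst \<kappa>)) (top_of_set (chart_image \<kappa>)) (snd \<kappa>)) \<and>
     (\<Union>\<kappa>\<in>\<A>. fst \<kappa>) = topspace M \<and>
     (\<forall>\<kappa>\<in>\<A>. \<forall>\<kappa>'\<in>\<A>. smooth_on (snd \<kappa> ` (fst \<kappa> \<inter> fst \<kappa>')) (transition \<kappa> \<kappa>'))"

definition compact_manifold :: "'m topology \<Rightarrow> ('m, 'n::finite) chart set \<Rightarrow> bool" where
  "compact_manifold M \<A> \<longleftrightarrow>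
     Hausdorff_space M \<and> second_countable M \<and> compact_space M \<and> smooth_atlas M \<A>"

text \<open>A time-dependent tensor field is given by its components in all charts of the atlas:
  \<open>g \<kappa> t y u v\<close> is the value of \<open>g(t)\<close> at the point with \<open>\<kappa>\<close>-coordinates \<open>y\<close> on the tangent vectors
  with \<open>\<kappa>\<close>-components \<open>u\<close> and \<open>v\<close>. The last clause of the following definition is the
  transformation law which makes these components those of one tensor field on \<open>M\<close>.\<close>

type_synonym ('m, 'n) metric_family =
  "('m, 'n) chart \<Rightarrow> real \<Rightarrow> real ^ 'n \<Rightarrow> real ^ 'n \<Rightarrow> real ^ 'n \<Rightarrow> real"

definition riemannian_family ::
  "('m, 'n::finite) chart set \<Rightarrow> real \<Rightarrow> ('m, 'n) metric_family \<Rightarrow> bool" where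
  "riemannian_family \<A> T g \<longleftrightarrow>
     (\<forall>\<kappa>\<in>\<A>. \<forall>t\<in>{0..T}. \<forall>y\<in>chart_image \<kappa>.
        bilinear (g \<kappa> t y) \<and> (\<forall>u v. g \<kappa> t y u v = g \<kappa> t y v u) \<and> (\<forall>u. u \<noteq> 0 \<longrightarrow> 0 < g \<kappa> t y u u)) \<and>
     (\<forall>\<kappa>\<in>\<A>. \<forall>u v. smooth_on (chart_image \<kappa> \<times> {0..T}) (\<lambda>(y, t). g \<kappa> t y u v)) \<and>
     (\<forall>\<kappa>\<in>\<A>. \<forall>\<kappa>'\<in>\<A>. \<forall>t\<in>{0..T}. \<forall>p\<in>fst \<kappa> \<inter> fst \<kappa>'. \<forall>u v.
        g \<kappa> t (snd \<kappa> p) u v =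
        g \<kappa>' t (snd \<kappa>' p) (frechet_derivative (transition \<kappa> \<kappa>') (at (snd \<kappa> p)) u)
                          (frechet_derivative (transition \<kappa> \<kappa>') (at (snd \<kappa> p)) v))"

definition ricci_flow ::
  "('m, 'n::finite) chart set \<Rightarrow> real \<Rightarrow> ('m, 'n) metric_family \<Rightarrow> bool" where
  "ricci_flow \<A> T g \<longleftrightarrow> riemannian_family \<A> T g \<and>
     (\<forall>\<kappa>\<in>\<A>. \<forall>t\<in>{0..T}. \<forall>y\<in>chart_image \<kappa>. \<forall>u v.
        ((\<lambda>\<tau>. g \<kappa> \<tau> y u v) has_real_derivative - 2 * Ric (chart_image \<kappa>) (g \<kappa> t) y u v)
          (at t within {0..T}))"

text \<open>The metric \<open>g(t) + dt\<^sup>2\<close> on \<open>M \<times> I\<close>, in the product of a chart of \<open>M\<close> with the coordinate \<open>t\<close>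
  of \<open>I\<close>. Tangent vectors are pairs of a horizontal and a vertical component.\<close>

definition product_metric ::
  "(real \<Rightarrow> 'a::euclidean_space \<Rightarrow> 'a \<Rightarrow> 'a \<Rightarrow> real) \<Rightarrow>
   'a \<times> real \<Rightarrow> 'a \<times> real \<Rightarrow> 'a \<times> real \<Rightarrow> real" where
  "product_metric G p U V = G (snd p) (fst p) (fst U) (fst V) + snd U * snd V"

definition hor :: "'a::euclidean_space \<Rightarrow> 'a \<times> real" where
  "hor u = (u, 0)"


section \<open>Families of curves\<close>

text \<open>The circle is the unit circle in the complex plane, with coordinate \<open>x \<mapsto> cis x\<close>. The following is
  the coordinate expression of \<open>c\<close> as a function of \<open>x\<close> and \<open>t\<close>, meaningful where \<open>c (cis x) t\<close> lies
  in the chart domain.\<close>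

definition in_chart ::
  "('m, 'n::finite) chart \<Rightarrow> (complex \<Rightarrow> real \<Rightarrow> 'm) \<Rightarrow> real \<Rightarrow> real \<Rightarrow> real ^ 'n" where
  "in_chart \<kappa> c x t = snd \<kappa> (c (cis x) t)"

definition immersed_curve_family ::
  "'m topology \<Rightarrow> ('m, 'n::finite) chart set \<Rightarrow> real \<Rightarrow> (complex \<Rightarrow> real \<Rightarrow> 'm) \<Rightarrow> bool" where
  "immersed_curve_family M \<A> T c \<longleftrightarrow>
     continuous_map (top_of_set (sphere 0 1 \<times> {0..T})) M (\<lambda>(z, t). c z t) \<and>
     (\<forall>\<kappa>\<in>\<A>. smooth_on {(x, t). t \<in> {0..T} \<and> c (cis x) t \<in> fst \<kappa>} (\<lambda>(x, t). in_chart \<kappa> c x t)) \<and>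
     (\<forall>\<kappa>\<in>\<A>. \<forall>x. \<forall>t\<in>{0..T}. c (cis x) t \<in> fst \<kappa> \<longrightarrow>
        vector_derivative (\<lambda>\<xi>. in_chart \<kappa> c \<xi> t) (at x) \<noteq> 0)"

text \<open>In the remaining definitions \<open>W\<close>, \<open>G\<close> and \<open>\<gamma>\<close> are the image of a chart and the expressions of the
  metrics \<open>g(t)\<close> and of \<open>c\<close> in that chart. First \<open>S\<close> and \<open>H = \<nabla>\<^sup>g\<^sub>S S\<close>, as fields on \<open>M\<close> along \<open>c\<close>; here
  \<open>\<nabla>\<^sub>S\<close> is the covariant derivative along \<open>x \<mapsto> \<gamma> x t\<close> divided by the length of the velocity.\<close>

definition speed ::
  "(real \<Rightarrow> 'a::euclidean_space \<Rightarrow> 'a \<Rightarrow> 'a \<Rightarrow> real) \<Rightarrow> (real \<Rightarrow> real \<Rightarrow> 'a) \<Rightarrow> real \<Rightarrow> real \<Rightarrow> real" where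
  "speed G \<gamma> x t = (let v = vector_derivative (\<lambda>\<xi>. \<gamma> \<xi> t) (at x) in sqrt (G t (\<gamma> x t) v v))"

definition unit_tangent ::
  "(real \<Rightarrow> 'a::euclidean_space \<Rightarrow> 'a \<Rightarrow> 'a \<Rightarrow> real) \<Rightarrow> (real \<Rightarrow> real \<Rightarrow> 'a) \<Rightarrow> real \<Rightarrow> real \<Rightarrow> 'a" where
  "unit_tangent G \<gamma> x t = vector_derivative (\<lambda>\<xi>. \<gamma> \<xi> t) (at x) /\<^sub>R speed G \<gamma> x t"

definition curvature_vector ::
  "'a set \<Rightarrow> (real \<Rightarrow> 'a::euclidean_space \<Rightarrow> 'a \<Rightarrow> 'a \<Rightarrow> real) \<Rightarrow> (real \<Rightarrow> real \<Rightarrow> 'a) \<Rightarrow>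
   real \<Rightarrow> real \<Rightarrow> 'a" where
  "curvature_vector W G \<gamma> x t =
     cov_along W (G t) (\<lambda>\<xi>. \<gamma> \<xi> t) (\<lambda>\<xi>. unit_tangent G \<gamma> \<xi> t) x /\<^sub>R speed G \<gamma> x t"

definition curve_shrinking ::
  "('m, 'n::finite) chart set \<Rightarrow> real \<Rightarrow> ('m, 'n) metric_family \<Rightarrow> (complex \<Rightarrow> real \<Rightarrow> 'm) \<Rightarrow> bool" where
  "curve_shrinking \<A> T g c \<longleftrightarrow>
     (\<forall>\<kappa>\<in>\<A>. \<forall>x. \<forall>t\<in>{0..T}. c (cis x) t \<in> fst \<kappa> \<longrightarrow>
        ((\<lambda>\<tau>. in_chart \<kappa> c x \<tau>) has_vector_derivative
           curvature_vector (chart_image \<kappa>) (g \<kappa>) (in_chart \<kappa> c) x t) (at t within {0..T}))"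

text \<open>The immersion \<open>(x, t) \<mapsto> (c(x, t), t)\<close> and its coordinate fields \<open>X\<close> and \<open>H + \<partial>\<^sub>t\<close>.\<close>

definition graph_map :: "(real \<Rightarrow> real \<Rightarrow> 'a::euclidean_space) \<Rightarrow> real \<Rightarrow> real \<Rightarrow> 'a \<times> real" where
  "graph_map \<gamma> x t = (\<gamma> x t, t)"

definition field_X :: "(real \<Rightarrow> real \<Rightarrow> 'a::euclidean_space) \<Rightarrow> real \<Rightarrow> real \<Rightarrow> 'a \<times> real" where
  "field_X \<gamma> x t = vector_derivative (\<lambda>\<xi>. graph_map \<gamma> \<xi> t) (at x)"

definition field_Hhat :: "real \<Rightarrow> (real \<Rightarrow> real \<Rightarrow> 'a::euclidean_space) \<Rightarrow> real \<Rightarrow> real \<Rightarrow> 'a \<times> real" where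
  "field_Hhat T \<gamma> x t = vector_derivative (\<lambda>\<tau>. graph_map \<gamma> x \<tau>) (at t within {0..T})"

end

theory Submission
  imports Defs
begin

text \<open>The metrics and the curves are replaced near the given point by smooth extensions across
  \<open>t = 0\<close> and \<open>t = T\<close>; the Ricci flow and curve-shrinking equations then hold only for
  \<open>t \<in> {0..T}\<close>, but besides their validity on each time slice only their derivatives along the
  slices are needed. Put \<open>h = \<partial>\<^sub>t g = - 2 Ric\<close> and \<open>D\<^sub>t V = \<partial>\<^sub>t V + \<Gamma>(H, V)\<close>. Vanishing torsion gives
  \<open>D\<^sub>t X = D\<^sub>x H\<close>, and commuting \<open>D\<^sub>t\<close> with \<open>D\<^sub>x\<close> on \<open>S\<close> yields
  \<open>\<partial>\<^sub>t k\<^sup>2 = (k\<^sup>2)'' - 2 |D\<^sub>S H|\<^sup>2 + 4 k\<^sup>4 + h(H, H) - 2 k\<^sup>2 h(S, S) + 2 \<langle>R(H, S)S + (\<partial>\<^sub>t \<Gamma>)(S, S), H\<rangle>\<close>.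
  The term with \<open>\<partial>\<^sub>t \<Gamma>\<close> need not be computed: it is part of the curvature of \<open>g + dt\<^sup>2\<close>. Indeed
  the Levi-Civita connection of that metric has horizontal part \<open>\<Gamma>(u, v) + a P v + b P u\<close> and vertical part
  \<open>- h(u, v) / 2\<close> on \<open>(u, a), (v, b)\<close>, where \<open>\<langle>P u, w\<rangle> = h(u, w) / 2\<close>, so its curvature on
  \<open>(H + \<partial>\<^sub>t, S, H, S)\<close> is \<open>\<langle>R(H, S)S + (\<partial>\<^sub>t \<Gamma>)(S, S), H\<rangle>\<close> minus
  \<open>(\<nabla>\<^sub>S h)(S, H) / 2\<close> and minus \<open>(h(S, S) h(H, H) - h(S, H)\<^sup>2) / 4\<close>.\<close>

section \<open>Calculus of smooth functions\<close>

definition Cinf_on :: "'a set \<Rightarrow> ('a::real_normed_vector \<Rightarrow> 'b::real_normed_vector) \<Rightarrow> bool" where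
  "Cinf_on U f \<longleftrightarrow> (\<forall>k. Ck_on k U f)"

text \<open>The direction comes first so that \<open>dird v f\<close> is again a function of the
  point. This is the form in which \<open>Ck_on\<close> recurses, and it can be iterated.\<close>

definition dird ::
  "'a \<Rightarrow> ('a::real_normed_vector \<Rightarrow> 'b::real_normed_vector) \<Rightarrow> 'a \<Rightarrow> 'b" where
  "dird v f p = frechet_derivative f (at p) v"

lemma dirdI: "(f has_derivative f') (at p) \<Longrightarrow> dird v f p = f' v"
  by (simp add: dird_def frechet_derivative_at[symmetric])

lemma has_derivative_dird:
  "f differentiable at p \<Longrightarrow> (f has_derivative (\<lambda>v. dird v f p)) (at p)"
  by (simp add: dird_def frechet_derivative_works)

lemma Ck_on_Suc_dird:
  "Ck_on (Suc k) U f \<longleftrightarrow> (\<forall>p\<in>U. f differentiable at p) \<and> (\<forall>v. Ck_on k U (dird v f))"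
  by (simp add: dird_def[abs_def])

declare Ck_on.simps(2) [simp del]

text \<open>Both functions have the same candidate derivatives at \<open>p\<close>, so the choice in
  \<open>frechet_derivative\<close> picks the same map, whether or not a derivative exists.\<close>

lemma dird_cong:
  assumes "open U" "p \<in> U" "\<And>q. q \<in> U \<Longrightarrow> f q = g q"
  shows "dird v f p = dird v g p"
proof -
  have "(f has_derivative f') (at p) \<longleftrightarrow> (g has_derivative f') (at p)" for f'
    using assms by (metis has_derivative_transform_within_open)
  then show ?thesis
    by (simp add: dird_def frechet_derivative_def)
qed

lemma differentiable_cong_open:
  assumes "f differentiable at p" "open U" "p \<in> U" "\<And>q. q \<in> U \<Longrightarrow> f q = g q"
  shows "g differentiable at p"
  using assms has_derivative_transform_within_open unfolding differentiable_def by blast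

lemma Ck_on_cong:
  assumes "open U" "\<And>q. q \<in> U \<Longrightarrow> f q = g q" "Ck_on k U f"
  shows "Ck_on k U g"
  using assms(2,3)
proof (induction k arbitrary: f g)
  case 0
  then show ?case using continuous_on_cong by fastforce
next
  case (Suc k)
  have "dird v f q = dird v g q" if "q \<in> U" for q v
    using dird_cong[OF assms(1) that] Suc.prems(1) by blast
  moreover have "g differentiable at p" if "p \<in> U" for p
    using Suc.prems differentiable_cong_open[OF _ assms(1) that] that
    by (metis Ck_on.simps(2))
  ultimately show ?case
    using Suc.IH Suc.prems(2) unfolding Ck_on_Suc_dird by blast
qed

lemma Ck_on_pred: "Ck_on (Suc k) U f \<Longrightarrow> Ck_on k U f"
proof (induction k arbitrary: f)
  case 0
  then show ?case
    by (simp add: Ck_on_Suc_dird continuous_at_imp_continuous_on differentiable_imp_continuous_within)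
next
  case (Suc k)
  then show ?case unfolding Ck_on_Suc_dird by blast
qed

lemma Ck_on_subset: "Ck_on k U f \<Longrightarrow> V \<subseteq> U \<Longrightarrow> Ck_on k V f"
  by (induction k arbitrary: f) (auto simp: Ck_on_Suc_dird intro: continuous_on_subset)

section \<open>Closure of \<open>Ck_on\<close> under algebraic operations, square roots and
  composition\<close>

lemma Ck_on_const: "Ck_on k U (\<lambda>_. c)"
proof (induction k arbitrary: c)
  case (Suc k)
  have "dird v (\<lambda>_. c) = (\<lambda>_. 0)" for v :: 'a
    by (rule ext) (rule dirdI, rule has_derivative_const)
  then show ?case using Suc unfolding Ck_on_Suc_dird by simp
qed simp

text \<open>Carries the inductions below: \<open>D v\<close> is the expression delivered by a
  differentiation rule, and on the open set \<open>U\<close> it may replace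
  \<open>dird v f\<close>.\<close>

lemma Ck_on_SucI:
  assumes "open U" "\<And>p. p \<in> U \<Longrightarrow> (f has_derivative (\<lambda>v. D v p)) (at p)" "\<And>v. Ck_on k U (D v)"
  shows "Ck_on (Suc k) U f"
proof -
  have "Ck_on k U (dird v f)" for v
    by (rule Ck_on_cong[OF assms(1) _ assms(3)]) (simp add: dirdI[OF assms(2)])
  then show ?thesis using assms(2) unfolding Ck_on_Suc_dird differentiable_def by blast
qed

lemma Ck_on_SucD:
  assumes "Ck_on (Suc k) U f"
  shows "p \<in> U \<Longrightarrow> (f has_derivative (\<lambda>v. dird v f p)) (at p)" "Ck_on k U (dird v f)" "Ck_on k U f"
  using assms Ck_on_pred has_derivative_dird unfolding Ck_on_Suc_dird by blast+

lemma Ck_on_bounded_linear: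
  assumes "bounded_linear L" "open U" "Ck_on k U f"
  shows "Ck_on k U (\<lambda>p. L (f p))"
  using assms(3)
proof (induction k arbitrary: f)
  case 0
  then show ?case using assms(1) bounded_linear.continuous_on by auto
next
  case (Suc k)
  note f = Ck_on_SucD[OF Suc.prems]
  show ?case
    by (rule Ck_on_SucI[OF assms(2) bounded_linear.has_derivative[OF assms(1) f(1)] Suc.IH[OF f(2)]])
qed

lemma Ck_on_add:
  assumes "open U" "Ck_on k U f" "Ck_on k U g"
  shows "Ck_on k U (\<lambda>p. f p + g p)"
  using assms(2,3)
proof (induction k arbitrary: f g)
  case 0
  then show ?case by (simp add: continuous_on_add)
next
  case (Suc k)
  note f = Ck_on_SucD[OF Suc.prems(1)] and g = Ck_on_SucD[OF Suc.prems(2)]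
  show ?case
    by (rule Ck_on_SucI[OF assms(1) has_derivative_add[OF f(1) g(1)] Suc.IH[OF f(2) g(2)]])
qed

lemma Ck_on_bounded_bilinear:
  assumes "bounded_bilinear B" "open U" "Ck_on k U f" "Ck_on k U g"
  shows "Ck_on k U (\<lambda>p. B (f p) (g p))"
  using assms(3,4)
proof (induction k arbitrary: f g)
  case 0
  then show ?case using bounded_bilinear.continuous_on[OF assms(1)] by auto
next
  case (Suc k)
  note f = Ck_on_SucD[OF Suc.prems(1)] and g = Ck_on_SucD[OF Suc.prems(2)]
  show ?case
    by (rule Ck_on_SucI[OF assms(2) bounded_bilinear.FDERIV[OF assms(1) f(1) g(1)]
          Ck_on_add[OF assms(2) Suc.IH[OF f(3) g(2)] Suc.IH[OF f(2) g(3)]]])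
qed

lemma Ck_on_sum:
  assumes "open U" "\<And>i. i \<in> I \<Longrightarrow> Ck_on k U (f i)"
  shows "Ck_on k U (\<lambda>p. \<Sum>i\<in>I. f i p)"
  using assms(2)
  by (induction I rule: infinite_finite_induct) (simp_all add: Ck_on_const Ck_on_add[OF assms(1)])

lemma Ck_on_prod:
  fixes f :: "'i \<Rightarrow> 'a::real_normed_vector \<Rightarrow> 'b::real_normed_field"
  assumes "open U" "\<And>i. i \<in> I \<Longrightarrow> Ck_on k U (f i)"
  shows "Ck_on k U (\<lambda>p. \<Prod>i\<in>I. f i p)"
  using assms(2)
  by (induction I rule: infinite_finite_induct)
     (simp_all add: Ck_on_const Ck_on_bounded_bilinear[OF bounded_bilinear_mult assms(1)])

text \<open>The derivative consists of the derivative of \<open>f\<close> between two factors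
  \<open>inverse (f p)\<close> and a sign, so order \<open>k\<close> for the inverse itself yields
  order \<open>Suc k\<close>.\<close>

lemma Ck_on_inverse:
  fixes f :: "'a::real_normed_vector \<Rightarrow> 'b::real_normed_field"
  assumes "open U" "Ck_on k U f" "\<And>p. p \<in> U \<Longrightarrow> f p \<noteq> 0"
  shows "Ck_on k U (\<lambda>p. inverse (f p))"
  using assms(2)
proof (induction k)
  case 0
  then show ?case using assms(3) by (auto intro: continuous_on_inverse)
next
  case (Suc k)
  note f = Ck_on_SucD[OF Suc.prems]
  note mult = Ck_on_bounded_bilinear[OF bounded_bilinear_mult assms(1)]
  note inv = Suc.IH[OF f(3)]
  show ?case
    by (rule Ck_on_SucI[OF assms(1) Deriv.has_derivative_inverse[OF assms(3) f(1)]
          Ck_on_bounded_linear[OF bounded_linear_minus[OF bounded_linear_ident] assms(1)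
            mult[OF mult[OF inv f(2)] inv]]])
qed

lemma Ck_on_sqrt:
  fixes f :: "'a::real_normed_vector \<Rightarrow> real"
  assumes "open U" "Ck_on k U f" "\<And>p. p \<in> U \<Longrightarrow> 0 < f p"
  shows "Ck_on k U (\<lambda>p. sqrt (f p))"
  using assms(2)
proof (induction k)
  case 0
  then show ?case by (auto intro: continuous_on_real_sqrt)
next
  case (Suc k)
  note f = Ck_on_SucD[OF Suc.prems]
  have "Ck_on k U (\<lambda>p. inverse (sqrt (f p)) / 2)"
    by (rule Ck_on_bounded_linear[OF bounded_linear_divide assms(1)],
        rule Ck_on_inverse[OF assms(1) Suc.IH[OF f(3)]]) (use assms(3) in force)
  note D = Ck_on_bounded_bilinear[OF bounded_bilinear_mult assms(1) f(2) this]
  show ?case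
    by (rule Ck_on_SucI[OF assms(1) has_derivative_real_sqrt[OF assms(3) f(1)] D])
qed

lemma dird_Basis:
  fixes f :: "'a::euclidean_space \<Rightarrow> 'b::real_normed_vector"
  assumes "f differentiable at p"
  shows "dird v f p = (\<Sum>e\<in>Basis. (v \<bullet> e) *\<^sub>R dird e f p)"
proof -
  interpret bounded_linear "\<lambda>v. dird v f p"
    using has_derivative_dird[OF assms] by (rule has_derivative_bounded_linear)
  show ?thesis
    by (subst (1) euclidean_representation[of v, symmetric]) (simp only: sum scaleR)
qed

text \<open>In the chain rule the direction \<open>dird v q p\<close> depends on \<open>p\<close>,
  whereas the recursion of \<open>Ck_on\<close> uses fixed directions. Expanding it in the standard
  basis leaves fixed directions \<open>e\<close> with coefficients of class
  \<open>Ck_on k\<close>.\<close>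

lemma Ck_on_compose:
  fixes f :: "'b::euclidean_space \<Rightarrow> 'c::real_normed_vector" and q :: "'a::real_normed_vector \<Rightarrow> 'b"
  assumes "open U" "Ck_on k U q" "\<And>p. p \<in> U \<Longrightarrow> q p \<in> V" "Ck_on k V f"
  shows "Ck_on k U (\<lambda>p. f (q p))"
  using assms(2,4)
proof (induction k arbitrary: f)
  case 0
  then show ?case using assms(3) continuous_on_compose2 by (metis Ck_on.simps(1) image_subsetI)
next
  case (Suc k)
  note q = Ck_on_SucD[OF Suc.prems(1)] and f = Ck_on_SucD[OF Suc.prems(2)]
  have D: "((\<lambda>p. f (q p)) has_derivative (\<lambda>v. \<Sum>e\<in>Basis. (dird v q p \<bullet> e) *\<^sub>R dird e f (q p))) (at p)"
    if "p \<in> U" for p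
    using has_derivative_compose[OF q(1) f(1)] dird_Basis[OF differentiableI[OF f(1)]] assms(3) that
    by simp
  show ?case
    by (rule Ck_on_SucI[OF assms(1) D], assumption, intro Ck_on_sum assms(1)
        Ck_on_bounded_bilinear[OF bounded_bilinear_scaleR]
        Ck_on_bounded_linear[OF bounded_linear_inner_left] q(2) Suc.IH[OF q(3) f(2)])
qed

section \<open>Smooth functions: the same rules for all orders at once\<close>

lemma Cinf_on_differentiable: "Cinf_on U f \<Longrightarrow> p \<in> U \<Longrightarrow> f differentiable at p"
  unfolding Cinf_on_def by (meson Ck_on_SucD(1) differentiableI)

lemma Cinf_on_continuous_on: "Cinf_on U f \<Longrightarrow> continuous_on U f"
  unfolding Cinf_on_def by (metis Ck_on.simps(1))

lemma Cinf_on_has_derivative: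
  "Cinf_on U f \<Longrightarrow> p \<in> U \<Longrightarrow> (f has_derivative (\<lambda>v. dird v f p)) (at p)"
  by (rule has_derivative_dird[OF Cinf_on_differentiable])

lemma Cinf_on_dird: "Cinf_on U f \<Longrightarrow> Cinf_on U (dird v f)"
  unfolding Cinf_on_def by (metis Ck_on_SucD(2))

lemma Cinf_on_cong: "open U \<Longrightarrow> (\<And>q. q \<in> U \<Longrightarrow> f q = g q) \<Longrightarrow> Cinf_on U f \<Longrightarrow> Cinf_on U g"
  unfolding Cinf_on_def using Ck_on_cong by blast

lemma Cinf_on_subset: "Cinf_on U f \<Longrightarrow> V \<subseteq> U \<Longrightarrow> Cinf_on V f"
  unfolding Cinf_on_def using Ck_on_subset by blast

lemma Cinf_on_const: "Cinf_on U (\<lambda>_. c)"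
  unfolding Cinf_on_def using Ck_on_const by blast

lemma Cinf_on_bounded_linear:
  "bounded_linear L \<Longrightarrow> open U \<Longrightarrow> Cinf_on U f \<Longrightarrow> Cinf_on U (\<lambda>p. L (f p))"
  unfolding Cinf_on_def using Ck_on_bounded_linear by blast

lemma Cinf_on_add: "open U \<Longrightarrow> Cinf_on U f \<Longrightarrow> Cinf_on U g \<Longrightarrow> Cinf_on U (\<lambda>p. f p + g p)"
  unfolding Cinf_on_def using Ck_on_add by blast

lemma Cinf_on_bounded_bilinear:
  "bounded_bilinear B \<Longrightarrow> open U \<Longrightarrow> Cinf_on U f \<Longrightarrow> Cinf_on U g \<Longrightarrow> Cinf_on U (\<lambda>p. B (f p) (g p))"
  unfolding Cinf_on_def using Ck_on_bounded_bilinear by blast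

lemmas Cinf_on_mult = Cinf_on_bounded_bilinear[OF bounded_bilinear_mult]
lemmas Cinf_on_scaleR = Cinf_on_bounded_bilinear[OF bounded_bilinear_scaleR]
lemmas Cinf_on_inner_const = Cinf_on_bounded_linear[OF bounded_linear_inner_left]

lemma Cinf_on_sum:
  "open U \<Longrightarrow> (\<And>i. i \<in> I \<Longrightarrow> Cinf_on U (f i)) \<Longrightarrow> Cinf_on U (\<lambda>p. \<Sum>i\<in>I. f i p)"
  unfolding Cinf_on_def by (simp add: Ck_on_sum)

lemma Cinf_on_prod:
  fixes f :: "'i \<Rightarrow> 'a::real_normed_vector \<Rightarrow> 'b::real_normed_field"
  shows "open U \<Longrightarrow> (\<And>i. i \<in> I \<Longrightarrow> Cinf_on U (f i)) \<Longrightarrow> Cinf_on U (\<lambda>p. \<Prod>i\<in>I. f i p)"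
  unfolding Cinf_on_def by (simp add: Ck_on_prod)

lemma Cinf_on_inverse:
  fixes f :: "'a::real_normed_vector \<Rightarrow> 'b::real_normed_field"
  shows "open U \<Longrightarrow> Cinf_on U f \<Longrightarrow> (\<And>p. p \<in> U \<Longrightarrow> f p \<noteq> 0) \<Longrightarrow> Cinf_on U (\<lambda>p. inverse (f p))"
  unfolding Cinf_on_def by (simp add: Ck_on_inverse)

lemma Cinf_on_sqrt:
  fixes f :: "'a::real_normed_vector \<Rightarrow> real"
  shows "open U \<Longrightarrow> Cinf_on U f \<Longrightarrow> (\<And>p. p \<in> U \<Longrightarrow> 0 < f p) \<Longrightarrow> Cinf_on U (\<lambda>p. sqrt (f p))"
  unfolding Cinf_on_def by (simp add: Ck_on_sqrt)

lemma Cinf_on_compose: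
  fixes f :: "'b::euclidean_space \<Rightarrow> 'c::real_normed_vector"
  shows "open U \<Longrightarrow> Cinf_on U q \<Longrightarrow> (\<And>p. p \<in> U \<Longrightarrow> q p \<in> V) \<Longrightarrow> Cinf_on V f \<Longrightarrow>
    Cinf_on U (\<lambda>p. f (q p))"
  unfolding Cinf_on_def by (auto intro: Ck_on_compose)

lemma Cinf_on_ident: "Cinf_on U (\<lambda>p. p)"
proof -
  have "Ck_on k U (\<lambda>p. p)" for k
  proof (cases k)
    case (Suc k)
    have "dird v (\<lambda>p. p) = (\<lambda>_. v)" for v :: 'a
      by (rule ext) (rule dirdI, rule has_derivative_ident)
    then show ?thesis by (simp add: Suc Ck_on_Suc_dird Ck_on_const)
  qed simp
  then show ?thesis by (simp add: Cinf_on_def)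
qed

lemma Cinf_on_Basis:
  fixes f :: "'a::real_normed_vector \<Rightarrow> 'b::euclidean_space"
  assumes "open U" "\<And>e. e \<in> Basis \<Longrightarrow> Cinf_on U (\<lambda>p. f p \<bullet> e)"
  shows "Cinf_on U f"
proof -
  have "Cinf_on U (\<lambda>p. \<Sum>e\<in>Basis. (f p \<bullet> e) *\<^sub>R e)"
    by (intro Cinf_on_sum Cinf_on_scaleR assms Cinf_on_const)
  then show ?thesis by (simp add: euclidean_representation)
qed

lemma Cinf_on_Pair:
  assumes "open U" "Cinf_on U f" "Cinf_on U g"
  shows "Cinf_on U (\<lambda>p. (f p, g p))"
proof -
  have "bounded_linear (\<lambda>a. (a, 0))" "bounded_linear (\<lambda>b. (0, b))"
    by (intro bounded_linear_Pair bounded_linear_ident bounded_linear_zero)+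
  then have "Cinf_on U (\<lambda>p. (f p, 0) + (0, g p))"
    by (intro Cinf_on_add assms(1) Cinf_on_bounded_linear[OF _ assms(1,2)]
        Cinf_on_bounded_linear[OF _ assms(1,3)])
  then show ?thesis by simp
qed

section \<open>Symmetry of second derivatives\<close>

lemma dird_line:
  assumes "f differentiable at (q + a *\<^sub>R u)"
  shows "((\<lambda>a. f (q + a *\<^sub>R u)) has_vector_derivative dird u f (q + a *\<^sub>R u)) (at a)"
proof -
  have "((\<lambda>a. q + a *\<^sub>R u) has_derivative (\<lambda>h. h *\<^sub>R u)) (at a)"
    by (auto intro!: derivative_eq_intros)
  from has_derivative_compose[OF this has_derivative_dird[OF assms]]
  show ?thesis
    unfolding has_vector_derivative_def
    using linear_scale[OF has_derivative_linear[OF has_derivative_dird[OF assms]]]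
    by simp
qed

text \<open>Both mixed derivatives are, up to the factor \<open>d\<^sup>2\<close>, values at nearby points of the second
  difference of \<open>f\<close> over a square of side \<open>d\<close>.\<close>

lemma mixed_difference:
  fixes f :: "'a::real_normed_vector \<Rightarrow> real"
  assumes f: "Cinf_on U f" and "d > 0"
    and U: "\<And>a b. a \<in> {0..d} \<Longrightarrow> b \<in> {0..d} \<Longrightarrow> p + a *\<^sub>R u + b *\<^sub>R v \<in> U"
  obtains a b where "a \<in> {0..d}" "b \<in> {0..d}"
    "f (p + d *\<^sub>R u + d *\<^sub>R v) - f (p + d *\<^sub>R u) - f (p + d *\<^sub>R v) + f p
      = d * d * dird v (dird u f) (p + a *\<^sub>R u + b *\<^sub>R v)"
proof -
  let ?F = "\<lambda>a. f (p + a *\<^sub>R u + d *\<^sub>R v) - f (p + a *\<^sub>R u)"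
  have f1: "((\<lambda>a. f (p + a *\<^sub>R u + b *\<^sub>R v)) has_real_derivative dird u f (p + a *\<^sub>R u + b *\<^sub>R v))
     (at a)" if "a \<in> {0..d}" "b \<in> {0..d}" for a b
    using dird_line[of f "p + b *\<^sub>R v" a u] Cinf_on_differentiable[OF f U[OF that]]
    by (simp add: has_real_derivative_iff_has_vector_derivative add_ac)
  have f2: "((\<lambda>b. dird u f (p + a *\<^sub>R u + b *\<^sub>R v)) has_real_derivative
       dird v (dird u f) (p + a *\<^sub>R u + b *\<^sub>R v)) (at b)"
    if "a \<in> {0..d}" "b \<in> {0..d}" for a b
    using dird_line[of "dird u f" "p + a *\<^sub>R u" b v]
      Cinf_on_differentiable[OF Cinf_on_dird[OF f] U[OF that]]
    by (simp add: has_real_derivative_iff_has_vector_derivative)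
  have "(?F has_real_derivative
      dird u f (p + a *\<^sub>R u + d *\<^sub>R v) - dird u f (p + a *\<^sub>R u)) (at a)" if "a \<in> {0..d}" for a
    using DERIV_diff[OF f1[OF that, of d] f1[OF that, of 0]] \<open>d > 0\<close> by simp
  then obtain a where a: "0 < a" "a < d"
    "?F d - ?F 0 = (d - 0) * (dird u f (p + a *\<^sub>R u + d *\<^sub>R v) - dird u f (p + a *\<^sub>R u))"
    using MVT2[OF \<open>d > 0\<close>, of ?F "\<lambda>a. dird u f (p + a *\<^sub>R u + d *\<^sub>R v) - dird u f (p + a *\<^sub>R u)"]
    by auto
  obtain b where b: "0 < b" "b < d"
    "dird u f (p + a *\<^sub>R u + d *\<^sub>R v) - dird u f (p + a *\<^sub>R u + 0 *\<^sub>R v)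
      = (d - 0) * dird v (dird u f) (p + a *\<^sub>R u + b *\<^sub>R v)"
    using MVT2[OF \<open>d > 0\<close>, of "\<lambda>b. dird u f (p + a *\<^sub>R u + b *\<^sub>R v)"
        "\<lambda>b. dird v (dird u f) (p + a *\<^sub>R u + b *\<^sub>R v)"] f2[of a] a by auto
  show thesis
    by (rule that[of a b]) (use a b in auto)
qed

text \<open>If the two mixed derivatives differed at \<open>p\<close>, continuity would keep them
  apart nearby. But the second difference is symmetric in \<open>u\<close> and \<open>v\<close>, so
  \<open>mixed_difference\<close> in both orders gives them a common value at two points as close to
  \<open>p\<close> as desired.\<close>

lemma dird_commute_real:
  fixes f :: "'a::real_normed_vector \<Rightarrow> real"
  assumes f: "Cinf_on U f" and U: "open U" "p \<in> U"
  shows "dird u (dird v f) p = dird v (dird u f) p"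
proof (rule ccontr)
  assume ne: "dird u (dird v f) p \<noteq> dird v (dird u f) p"
  define \<epsilon> where "\<epsilon> = dist (dird u (dird v f) p) (dird v (dird u f) p) / 2"
  have "\<epsilon> > 0" using ne by (simp add: \<epsilon>_def)
  have "isCont (dird u (dird v f)) p" "isCont (dird v (dird u f)) p"
    using Cinf_on_continuous_on[OF Cinf_on_dird[OF Cinf_on_dird[OF f]]] U
      continuous_on_eq_continuous_at by blast+
  then obtain r1 r2 where r: "r1 > 0" "r2 > 0"
    "\<And>q. dist q p < r1 \<Longrightarrow> dist (dird u (dird v f) q) (dird u (dird v f) p) < \<epsilon>"
    "\<And>q. dist q p < r2 \<Longrightarrow> dist (dird v (dird u f) q) (dird v (dird u f) p) < \<epsilon>"
    using \<open>\<epsilon> > 0\<close> unfolding continuous_at_eps_delta by metis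
  obtain r0 where r0: "r0 > 0" "ball p r0 \<subseteq> U" using U openE by blast
  define r where "r = min r0 (min r1 r2)"
  have "r > 0" using r r0 by (simp add: r_def)
  \<comment> \<open>The parallelogram with sides \<open>d *\<^sub>R u\<close> and
    \<open>d *\<^sub>R v\<close> then stays within distance \<open>r\<close> of \<open>p\<close>;
    the summand 1 covers \<open>u = v = 0\<close>.\<close>
  define d where "d = r / (norm u + norm v + 1)"
  have dpos: "d > 0" unfolding d_def
    by (intro divide_pos_pos \<open>r > 0\<close>) (simp add: add_nonneg_pos)
  have near: "dist (p + a *\<^sub>R u + b *\<^sub>R v) p < r" if "a \<in> {0..d}" "b \<in> {0..d}" for a b
  proof -
    have "norm (a *\<^sub>R u + b *\<^sub>R v) \<le> d * norm u + d * norm v"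
      using norm_triangle_ineq[of "a *\<^sub>R u" "b *\<^sub>R v"] that
        mult_right_mono[of a d "norm u"] mult_right_mono[of b d "norm v"] by auto
    also have "\<dots> < d * (norm u + norm v + 1)" using dpos by (simp add: algebra_simps)
    also have "\<dots> = r" unfolding d_def
      using add_nonneg_pos[of "norm u + norm v" 1] by simp
    finally show ?thesis by (simp add: dist_norm algebra_simps)
  qed
  have near': "dist (p + a *\<^sub>R v + b *\<^sub>R u) p < r" if "a \<in> {0..d}" "b \<in> {0..d}" for a b
    using near[OF that(2,1)] by (simp add: add_ac)
  have inU: "p + a *\<^sub>R u + b *\<^sub>R v \<in> U" "p + a *\<^sub>R v + b *\<^sub>R u \<in> U"
    if "a \<in> {0..d}" "b \<in> {0..d}" for a b
    using near[OF that] near'[OF that] r0 by (auto simp: r_def dist_commute subset_iff)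
  obtain a b where ab: "a \<in> {0..d}" "b \<in> {0..d}"
    "f (p + d *\<^sub>R u + d *\<^sub>R v) - f (p + d *\<^sub>R u) - f (p + d *\<^sub>R v) + f p
      = d * d * dird v (dird u f) (p + a *\<^sub>R u + b *\<^sub>R v)"
    using mixed_difference[OF f dpos inU(1)] by metis
  obtain a' b' where ab': "a' \<in> {0..d}" "b' \<in> {0..d}"
    "f (p + d *\<^sub>R v + d *\<^sub>R u) - f (p + d *\<^sub>R v) - f (p + d *\<^sub>R u) + f p
      = d * d * dird u (dird v f) (p + a' *\<^sub>R v + b' *\<^sub>R u)"
    using mixed_difference[OF f dpos inU(2)] by metis
  have "d * d * dird v (dird u f) (p + a *\<^sub>R u + b *\<^sub>R v) = d * d * dird u (dird v f) (p + a' *\<^sub>R v + b' *\<^sub>R u)"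
    using ab(3) ab'(3) by (simp add: algebra_simps)
  then have eq: "dird v (dird u f) (p + a *\<^sub>R u + b *\<^sub>R v) = dird u (dird v f) (p + a' *\<^sub>R v + b' *\<^sub>R u)"
    using dpos by simp
  have "dist (dird v (dird u f) (p + a *\<^sub>R u + b *\<^sub>R v)) (dird v (dird u f) p) < \<epsilon>"
    "dist (dird u (dird v f) (p + a' *\<^sub>R v + b' *\<^sub>R u)) (dird u (dird v f) p) < \<epsilon>"
    using r near[OF ab(1,2)] near'[OF ab'(1,2)] by (auto simp: r_def)
  then show False
    using dist_triangle_half_r[of "dird u (dird v f) (p + a' *\<^sub>R v + b' *\<^sub>R u)" "dird u (dird v f) p"
        "dist (dird u (dird v f) p) (dird v (dird u f) p)" "dird v (dird u f) p"]
    unfolding eq \<epsilon>_def by simp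
qed

lemma dird_bounded_linear:
  assumes "bounded_linear L" "f differentiable at p"
  shows "dird v (\<lambda>p. L (f p)) p = L (dird v f p)"
  by (rule dirdI[OF bounded_linear.has_derivative[OF assms(1) has_derivative_dird[OF assms(2)]]])

lemma dird_commute:
  fixes f :: "'a::real_normed_vector \<Rightarrow> 'b::euclidean_space"
  assumes f: "Cinf_on U f" and U: "open U" "p \<in> U"
  shows "dird u (dird v f) p = dird v (dird u f) p"
proof (rule euclidean_eqI)
  fix e :: 'b assume "e \<in> Basis"
  have 1: "dird w (dird w' f) p \<bullet> e = dird w (dird w' (\<lambda>q. f q \<bullet> e)) p" for w w'
  proof -
    have "dird w (dird w' f) p \<bullet> e = dird w (\<lambda>q. dird w' f q \<bullet> e) p"
      using dird_bounded_linear[OF bounded_linear_inner_left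
          Cinf_on_differentiable[OF Cinf_on_dird[OF f] U(2)]] by metis
    also have "\<dots> = dird w (dird w' (\<lambda>q. f q \<bullet> e)) p"
      by (rule dird_cong[OF U])
         (metis dird_bounded_linear[OF bounded_linear_inner_left Cinf_on_differentiable[OF f]])
    finally show ?thesis .
  qed
  show "dird u (dird v f) p \<bullet> e = dird v (dird u f) p \<bullet> e"
    unfolding 1 by (rule dird_commute_real[OF Cinf_on_inner_const[OF U(1) f] U])
qed

lemma dird_add:
  "f differentiable at p \<Longrightarrow> g differentiable at p \<Longrightarrow>
    dird v (\<lambda>p. f p + g p) p = dird v f p + dird v g p"
  by (rule dirdI[OF has_derivative_add[OF has_derivative_dird has_derivative_dird]])

lemma dird_bounded_bilinear:
  "bounded_bilinear B \<Longrightarrow> f differentiable at p \<Longrightarrow> g differentiable at p \<Longrightarrow>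
    dird v (\<lambda>p. B (f p) (g p)) p = B (f p) (dird v g p) + B (dird v f p) (g p)"
  by (rule dirdI[OF bounded_bilinear.FDERIV[OF _ has_derivative_dird has_derivative_dird]])

lemmas dird_scaleR = dird_bounded_bilinear[OF bounded_bilinear_scaleR]
lemmas dird_mult = dird_bounded_bilinear[OF bounded_bilinear_mult]

lemma dird_const: "dird v (\<lambda>_. c) p = 0"
  by (rule dirdI[OF has_derivative_const])

lemma linear_dird: "f differentiable at p \<Longrightarrow> linear (\<lambda>v. dird v f p)"
  using has_derivative_linear has_derivative_dird by blast

text \<open>Agreement on one time slice is enough for the derivative in \<open>x\<close>. The
  curve-shrinking equation holds only for times in \<open>{0..T}\<close>, so it cannot be
  differentiated through \<open>dird_cong\<close>, which asks for agreement on an open set.\<close>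

lemma dird_line_eq:
  fixes f g :: "real \<times> real \<Rightarrow> 'b::real_normed_vector"
  assumes "f differentiable at (x, t)" "g differentiable at (x, t)"
    and "x \<in> J" "open J" "\<And>\<xi>. \<xi> \<in> J \<Longrightarrow> f (\<xi>, t) = g (\<xi>, t)"
  shows "dird (1, 0) f (x, t) = dird (1, 0) g (x, t)"
proof -
  have "((\<lambda>\<xi>. f (\<xi>, t)) has_vector_derivative dird (1, 0) f (x, t)) (at x)"
    "((\<lambda>\<xi>. g (\<xi>, t)) has_vector_derivative dird (1, 0) g (x, t)) (at x)"
    using dird_line[of f "(0, t)" x "(1, 0)"] dird_line[of g "(0, t)" x "(1, 0)"] assms(1,2)
    by simp_all
  with has_vector_derivative_transform_within_open[OF this(1) assms(4,3,5)]
  show ?thesis using vector_derivative_unique_at by blast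
qed

section \<open>Smooth families of bilinear maps and their Leibniz rule\<close>

definition Cinf_bilinear ::
  "'p set \<Rightarrow> ('p::real_normed_vector \<Rightarrow> 'a::euclidean_space \<Rightarrow> 'a \<Rightarrow> 'b::real_normed_vector) \<Rightarrow> bool" where
  "Cinf_bilinear \<Omega> F \<longleftrightarrow> (\<forall>p\<in>\<Omega>. bilinear (F p)) \<and> (\<forall>u v. Cinf_on \<Omega> (\<lambda>p. F p u v))"

lemma bilinear_Basis:
  assumes "bilinear (B :: 'a::euclidean_space \<Rightarrow> 'b::euclidean_space \<Rightarrow> 'c::real_vector)"
  shows "B u v = (\<Sum>i\<in>Basis. \<Sum>j\<in>Basis. (u \<bullet> i) *\<^sub>R (v \<bullet> j) *\<^sub>R B i j)"
proof -
  have "B u v = B (\<Sum>i\<in>Basis. (u \<bullet> i) *\<^sub>R i) (\<Sum>j\<in>Basis. (v \<bullet> j) *\<^sub>R j)"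
    by (simp add: euclidean_representation)
  also have "\<dots> = (\<Sum>i\<in>Basis. \<Sum>j\<in>Basis. (u \<bullet> i) *\<^sub>R (v \<bullet> j) *\<^sub>R B i j)"
    by (simp add: bilinear_sum[OF assms] sum.cartesian_product bilinear_lmul[OF assms]
        bilinear_rmul[OF assms] split_def mult.commute)
  finally show ?thesis .
qed

lemma Cinf_bilinear_dird:
  assumes F: "Cinf_bilinear \<Omega> F" and "open \<Omega>"
  shows "Cinf_bilinear \<Omega> (\<lambda>p u v. dird \<zeta> (\<lambda>p. F p u v) p)"
  unfolding Cinf_bilinear_def
proof (intro conjI ballI allI)
  fix p assume p: "p \<in> \<Omega>"
  have bil: "bilinear (F q)" if "q \<in> \<Omega>" for q
    using F that by (simp add: Cinf_bilinear_def)
  have diff: "(\<lambda>p. F p u v) differentiable at p" for u v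
    using F p by (auto simp: Cinf_bilinear_def intro: Cinf_on_differentiable)
  note cong = dird_cong[OF \<open>open \<Omega>\<close> p]
  have add: "dird \<zeta> (\<lambda>p. F p (u + u') v) p = dird \<zeta> (\<lambda>p. F p u v) p + dird \<zeta> (\<lambda>p. F p u' v) p"
    "dird \<zeta> (\<lambda>p. F p v (u + u')) p = dird \<zeta> (\<lambda>p. F p v u) p + dird \<zeta> (\<lambda>p. F p v u') p" for u u' v
    by (subst dird_add[OF diff diff, symmetric], rule cong, simp add: bilinear_ladd[OF bil] bilinear_radd[OF bil])+
  have scale: "dird \<zeta> (\<lambda>p. F p (c *\<^sub>R u) v) p = c *\<^sub>R dird \<zeta> (\<lambda>p. F p u v) p"
    "dird \<zeta> (\<lambda>p. F p v (c *\<^sub>R u)) p = c *\<^sub>R dird \<zeta> (\<lambda>p. F p v u) p" for c u v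
    by (subst dird_bounded_linear[OF bounded_linear_scaleR_right diff, symmetric], rule cong,
        simp add: bilinear_lmul[OF bil] bilinear_rmul[OF bil])+
  show "bilinear (\<lambda>u v. dird \<zeta> (\<lambda>p. F p u v) p)"
    unfolding bilinear_def by (intro conjI allI linearI add scale)
next
  show "Cinf_on \<Omega> (\<lambda>p. dird \<zeta> (\<lambda>p. F p u v) p)" for u v
    using Cinf_on_dird[of \<Omega> "\<lambda>p. F p u v" \<zeta>] F by (simp add: Cinf_bilinear_def)
qed

lemma Cinf_on_bilinear_field:
  fixes F :: "'p::euclidean_space \<Rightarrow> 'a::euclidean_space \<Rightarrow> 'a \<Rightarrow> 'b::real_normed_vector"
  assumes F: "Cinf_bilinear \<Omega> F" and N: "open N" and q: "Cinf_on N q" "\<And>z. z \<in> N \<Longrightarrow> q z \<in> \<Omega>"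
    and V: "Cinf_on N V" and W: "Cinf_on N W"
  shows "Cinf_on N (\<lambda>z. F (q z) (V z) (W z))"
proof -
  have "Cinf_on N (\<lambda>z. F (q z) i j)" for i j
    by (rule Cinf_on_compose[OF N q]) (use F in \<open>auto simp: Cinf_bilinear_def\<close>)
  then have "Cinf_on N (\<lambda>z. \<Sum>i\<in>Basis. \<Sum>j\<in>Basis. (V z \<bullet> i) *\<^sub>R (W z \<bullet> j) *\<^sub>R F (q z) i j)"
    by (intro Cinf_on_sum N Cinf_on_scaleR Cinf_on_inner_const V W)
  then show ?thesis
    by (rule Cinf_on_cong[OF N, rotated])
       (rule bilinear_Basis[symmetric], use F q(2) in \<open>simp add: Cinf_bilinear_def\<close>)
qed

text \<open>Leibniz rule in which the base point moves together with both arguments. In the standard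
  basis the expression is a sum of coordinates times \<open>F (q z) i j\<close>, to which the
  product and chain rules apply; the three resulting sums are again basis expansions.\<close>

lemma dird_bilinear_field:
  fixes F :: "'p::euclidean_space \<Rightarrow> 'a::euclidean_space \<Rightarrow> 'a \<Rightarrow> 'b::real_normed_vector"
  assumes F: "Cinf_bilinear \<Omega> F" and \<Omega>: "open \<Omega>" and N: "open N"
    and q: "Cinf_on N q" "\<And>z. z \<in> N \<Longrightarrow> q z \<in> \<Omega>"
    and V: "Cinf_on N V" and W: "Cinf_on N W" and z: "z \<in> N"
  shows "dird \<zeta> (\<lambda>z. F (q z) (V z) (W z)) z =
    dird (dird \<zeta> q z) (\<lambda>p. F p (V z) (W z)) (q z) + F (q z) (dird \<zeta> V z) (W z) + F (q z) (V z) (dird \<zeta> W z)"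
proof -
  have bil: "bilinear (F (q z))" if "z \<in> N" for z
    using F q(2) that by (auto simp: Cinf_bilinear_def)
  have "((\<lambda>z. F (q z) i j) has_derivative (\<lambda>\<zeta>. dird (dird \<zeta> q z) (\<lambda>p. F p i j) (q z))) (at z)" for i j
    by (rule has_derivative_compose[OF Cinf_on_has_derivative[OF q(1) z] Cinf_on_has_derivative[of \<Omega>]])
       (use F q(2) z in \<open>auto simp: Cinf_bilinear_def\<close>)
  then have "((\<lambda>z. \<Sum>i\<in>Basis. \<Sum>j\<in>Basis. (V z \<bullet> i) *\<^sub>R (W z \<bullet> j) *\<^sub>R F (q z) i j) has_derivative
    (\<lambda>\<zeta>. \<Sum>i\<in>Basis. \<Sum>j\<in>Basis.
       (V z \<bullet> i) *\<^sub>R ((W z \<bullet> j) *\<^sub>R dird (dird \<zeta> q z) (\<lambda>p. F p i j) (q z) + (dird \<zeta> W z \<bullet> j) *\<^sub>R F (q z) i j)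
       + (dird \<zeta> V z \<bullet> i) *\<^sub>R (W z \<bullet> j) *\<^sub>R F (q z) i j)) (at z)"
    by (intro has_derivative_sum has_derivative_scaleR has_derivative_inner_left
        Cinf_on_has_derivative[OF V z] Cinf_on_has_derivative[OF W z])
  from dirdI[OF this, of \<zeta>]
  have "dird \<zeta> (\<lambda>z. \<Sum>i\<in>Basis. \<Sum>j\<in>Basis. (V z \<bullet> i) *\<^sub>R (W z \<bullet> j) *\<^sub>R F (q z) i j) z =
    (\<Sum>i\<in>Basis. \<Sum>j\<in>Basis. (V z \<bullet> i) *\<^sub>R (W z \<bullet> j) *\<^sub>R dird (dird \<zeta> q z) (\<lambda>p. F p i j) (q z))
    + (\<Sum>i\<in>Basis. \<Sum>j\<in>Basis. (dird \<zeta> V z \<bullet> i) *\<^sub>R (W z \<bullet> j) *\<^sub>R F (q z) i j)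
    + (\<Sum>i\<in>Basis. \<Sum>j\<in>Basis. (V z \<bullet> i) *\<^sub>R (dird \<zeta> W z \<bullet> j) *\<^sub>R F (q z) i j)"
    by (simp add: sum.distrib scaleR_add_right)
  also have "\<dots> = dird (dird \<zeta> q z) (\<lambda>p. F p (V z) (W z)) (q z) + F (q z) (dird \<zeta> V z) (W z)
      + F (q z) (V z) (dird \<zeta> W z)"
    using Cinf_bilinear_dird[OF F \<Omega>, of "dird \<zeta> q z"] q(2)[OF z]
    by (subst bilinear_Basis[of "\<lambda>u v. dird (dird \<zeta> q z) (\<lambda>p. F p u v) (q z)" "V z"],
        simp add: Cinf_bilinear_def,
        subst bilinear_Basis[OF bil[OF z], of "dird \<zeta> V z"],
        subst bilinear_Basis[OF bil[OF z], of "V z"]) (rule refl)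
  also have "dird \<zeta> (\<lambda>z. \<Sum>i\<in>Basis. \<Sum>j\<in>Basis. (V z \<bullet> i) *\<^sub>R (W z \<bullet> j) *\<^sub>R F (q z) i j) z
      = dird \<zeta> (\<lambda>z. F (q z) (V z) (W z)) z"
    by (rule dird_cong[OF N z]) (rule bilinear_Basis[OF bil, symmetric])
  finally show ?thesis .
qed


section \<open>Connections and covariant derivatives along a family of curves\<close>

text \<open>The base point runs through space-time, but compatibility concerns horizontal directions
  only: every slice has its own torsion-free metric connection, and \<open>t\<close> is a
  parameter.\<close>

locale metric_connection =
  fixes \<Omega> :: "('a::euclidean_space \<times> real) set"
    and G :: "'a \<times> real \<Rightarrow> 'a \<Rightarrow> 'a \<Rightarrow> real"
    and \<Gamma> :: "'a \<times> real \<Rightarrow> 'a \<Rightarrow> 'a \<Rightarrow> 'a"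
  assumes open_dom: "open \<Omega>"
    and metric: "Cinf_bilinear \<Omega> G"
    and connection: "Cinf_bilinear \<Omega> \<Gamma>"
    and metric_sym: "p \<in> \<Omega> \<Longrightarrow> G p u v = G p v u"
    and torsion_free: "p \<in> \<Omega> \<Longrightarrow> \<Gamma> p u v = \<Gamma> p v u"
    and compatible: "p \<in> \<Omega> \<Longrightarrow>
      dird (u, 0) (\<lambda>p. G p v w) p = G p (\<Gamma> p u v) w + G p v (\<Gamma> p u w)"
begin

text \<open>The tensor \<open>h\<close> of the overview. It is identified with
  \<open>- 2 Ric\<close> only at times in \<open>{0..T}\<close>, since at other times
  \<open>G\<close> is just an extension.\<close>

definition metric_dt :: "'a \<times> real \<Rightarrow> 'a \<Rightarrow> 'a \<Rightarrow> real" where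
  "metric_dt p u v = dird (0, 1) (\<lambda>p. G p u v) p"

text \<open>The horizontal part of the curvature \<open>R(a + \<partial>\<^sub>t, b) d\<close> of the connection \<open>\<partial>\<^sub>t\<close> extended by
  \<open>\<Gamma>\<close> in the horizontal directions; it contains the time derivative of \<open>\<Gamma>\<close>.\<close>

definition curv :: "'a \<times> real \<Rightarrow> 'a \<Rightarrow> 'a \<Rightarrow> 'a \<Rightarrow> 'a" where
  "curv p a b d = dird (a, 1) (\<lambda>p. \<Gamma> p b d) p - dird (b, 0) (\<lambda>p. \<Gamma> p a d) p
     + \<Gamma> p a (\<Gamma> p b d) - \<Gamma> p b (\<Gamma> p a d)"

lemma bilinear_metric: "p \<in> \<Omega> \<Longrightarrow> bilinear (G p)"
  using metric by (simp add: Cinf_bilinear_def)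

lemma bilinear_connection: "p \<in> \<Omega> \<Longrightarrow> bilinear (\<Gamma> p)"
  using connection by (simp add: Cinf_bilinear_def)

lemma Cinf_bilinear_metric_dt: "Cinf_bilinear \<Omega> metric_dt"
  using Cinf_bilinear_dird[OF metric open_dom] by (simp add: metric_dt_def[abs_def])

lemma bilinear_metric_dt: "p \<in> \<Omega> \<Longrightarrow> bilinear (metric_dt p)"
  using Cinf_bilinear_metric_dt by (simp add: Cinf_bilinear_def)

lemma differentiable_metric: "p \<in> \<Omega> \<Longrightarrow> (\<lambda>p. G p u v) differentiable at p"
  using metric by (auto simp: Cinf_bilinear_def intro: Cinf_on_differentiable)

lemma differentiable_connection: "p \<in> \<Omega> \<Longrightarrow> (\<lambda>p. \<Gamma> p u v) differentiable at p"
  using connection by (auto simp: Cinf_bilinear_def intro: Cinf_on_differentiable)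

text \<open>Lets \<open>X = \<sigma> S\<close> be replaced by \<open>S\<close> in the curvature term
  that arises from commuting \<open>Dt\<close> and \<open>Dx\<close>.\<close>

lemma curv_scaleR:
  assumes p: "p \<in> \<Omega>"
  shows "curv p a (c *\<^sub>R b) d = c *\<^sub>R curv p a b d"
proof -
  have bil: "bilinear (\<lambda>u v. dird \<zeta> (\<lambda>p. \<Gamma> p u v) p)" for \<zeta>
    using Cinf_bilinear_dird[OF connection open_dom] p by (simp add: Cinf_bilinear_def)
  have "dird (c *\<^sub>R b, 0) (\<lambda>p. \<Gamma> p a d) p = c *\<^sub>R dird (b, 0) (\<lambda>p. \<Gamma> p a d) p"
    using linear_scale[OF linear_dird[OF differentiable_connection[OF p]], of c "(b, 0)"] by simp
  then show ?thesis
    using bilinear_lmul[OF bil]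
    by (simp add: curv_def bilinear_lmul[OF bilinear_connection[OF p]]
        bilinear_rmul[OF bilinear_connection[OF p]] scaleR_add_right scaleR_diff_right)
qed

end

text \<open>\<open>Y\<close> stands for the curve in a chart, extended smoothly to an open set of
  parameters. Positive speed is required on all of it, also at times outside \<open>{0..T}\<close>,
  so that \<open>\<sigma>\<close> and its inverse are smooth there.\<close>

locale moving_curve = metric_connection +
  fixes N :: "(real \<times> real) set" and Y :: "real \<times> real \<Rightarrow> 'a"
  assumes open_N: "open N"
    and smooth_Y: "Cinf_on N Y"
    and graph_in: "z \<in> N \<Longrightarrow> (Y z, snd z) \<in> \<Omega>"
    and immersed: "z \<in> N \<Longrightarrow> 0 < G (Y z, snd z) (dird (1, 0) Y z) (dird (1, 0) Y z)"
begin

definition q :: "real \<times> real \<Rightarrow> 'a \<times> real" where "q z = (Y z, snd z)"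

definition X :: "real \<times> real \<Rightarrow> 'a" where "X = dird (1, 0) Y"

text \<open>Kept apart from \<open>H\<close>: the equation \<open>E = H\<close> is available only at
  times in \<open>{0..T}\<close>.\<close>

definition E :: "real \<times> real \<Rightarrow> 'a" where "E = dird (0, 1) Y"

definition ip :: "(real \<times> real \<Rightarrow> 'a) \<Rightarrow> (real \<times> real \<Rightarrow> 'a) \<Rightarrow> real \<times> real \<Rightarrow> real" where
  "ip V W z = G (q z) (V z) (W z)"

definition Dx :: "(real \<times> real \<Rightarrow> 'a) \<Rightarrow> real \<times> real \<Rightarrow> 'a" where
  "Dx V z = dird (1, 0) V z + \<Gamma> (q z) (X z) (V z)"

definition Dt :: "(real \<times> real \<Rightarrow> 'a) \<Rightarrow> real \<times> real \<Rightarrow> 'a" where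
  "Dt V z = dird (0, 1) V z + \<Gamma> (q z) (E z) (V z)"

definition \<sigma> :: "real \<times> real \<Rightarrow> real" where "\<sigma> z = sqrt (ip X X z)"

definition S :: "real \<times> real \<Rightarrow> 'a" where "S z = inverse (\<sigma> z) *\<^sub>R X z"

definition H :: "real \<times> real \<Rightarrow> 'a" where "H z = inverse (\<sigma> z) *\<^sub>R Dx S z"

text \<open>The derivative of \<open>H\<close> in the direction \<open>S\<close> for the connection
  of the slice; the derivative for \<open>g + dt\<^sup>2\<close> has a vertical component in
  addition.\<close>

definition NH :: "real \<times> real \<Rightarrow> 'a" where "NH z = inverse (\<sigma> z) *\<^sub>R Dx H z"

text \<open>The logarithmic time derivative of the speed under the flow. The difference is written
  as a sum with the factor \<open>- 1\<close> to suit the closure rules of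
  \<open>Cinf_on\<close>.\<close>

definition \<nu> :: "real \<times> real \<Rightarrow> real" where
  "\<nu> z = metric_dt (q z) (S z) (S z) * (1 / 2) + (- 1) * ip H H z"

lemma q_in: "z \<in> N \<Longrightarrow> q z \<in> \<Omega>"
  using graph_in by (simp add: q_def)

lemma Cinf_snd: "Cinf_on U (snd :: real \<times> real \<Rightarrow> real)" if "open U"
  using Cinf_on_bounded_linear[OF bounded_linear_snd that Cinf_on_ident] by simp

lemma Cinf_q: "Cinf_on N q"
  unfolding q_def[abs_def] by (rule Cinf_on_Pair[OF open_N smooth_Y Cinf_snd[OF open_N]])

lemma Cinf_field:
  "Cinf_bilinear \<Omega> F \<Longrightarrow> Cinf_on N V \<Longrightarrow> Cinf_on N W \<Longrightarrow> Cinf_on N (\<lambda>z. F (q z) (V z) (W z))"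
  by (rule Cinf_on_bilinear_field[OF _ open_N Cinf_q q_in])

lemma dird_field:
  "Cinf_bilinear \<Omega> F \<Longrightarrow> Cinf_on N V \<Longrightarrow> Cinf_on N W \<Longrightarrow> z \<in> N \<Longrightarrow>
    dird \<zeta> (\<lambda>z. F (q z) (V z) (W z)) z =
      dird (dird \<zeta> q z) (\<lambda>p. F p (V z) (W z)) (q z) + F (q z) (dird \<zeta> V z) (W z) + F (q z) (V z) (dird \<zeta> W z)"
  by (rule dird_bilinear_field[OF _ open_dom open_N Cinf_q q_in])

lemma Cinf_X: "Cinf_on N X" and Cinf_E: "Cinf_on N E"
  unfolding X_def E_def by (rule Cinf_on_dird[OF smooth_Y])+

lemma Cinf_ip: "Cinf_on N V \<Longrightarrow> Cinf_on N W \<Longrightarrow> Cinf_on N (ip V W)"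
  unfolding ip_def[abs_def] by (rule Cinf_field[OF metric])

lemma Cinf_Dx: "Cinf_on N V \<Longrightarrow> Cinf_on N (Dx V)"
  unfolding Dx_def[abs_def]
  by (intro Cinf_on_add open_N Cinf_on_dird Cinf_X
      Cinf_field[OF connection])

lemma Cinf_Dt: "Cinf_on N V \<Longrightarrow> Cinf_on N (Dt V)"
  unfolding Dt_def[abs_def]
  by (intro Cinf_on_add open_N Cinf_on_dird Cinf_E
      Cinf_field[OF connection])

lemma ip_XX_pos: "z \<in> N \<Longrightarrow> 0 < ip X X z"
  using immersed by (simp add: ip_def q_def X_def)

lemma \<sigma>_pos: "z \<in> N \<Longrightarrow> 0 < \<sigma> z"
  using ip_XX_pos by (simp add: \<sigma>_def)

lemma \<sigma>_square: "z \<in> N \<Longrightarrow> \<sigma> z * \<sigma> z = ip X X z"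
  using ip_XX_pos[of z] by (simp add: \<sigma>_def)

lemma Cinf_\<sigma>: "Cinf_on N \<sigma>"
  unfolding \<sigma>_def[abs_def] by (intro Cinf_on_sqrt open_N Cinf_ip Cinf_X ip_XX_pos)

lemma Cinf_inverse_\<sigma>: "Cinf_on N (\<lambda>z. inverse (\<sigma> z))"
  by (rule Cinf_on_inverse[OF open_N Cinf_\<sigma>]) (use \<sigma>_pos in force)

lemma Cinf_S: "Cinf_on N S"
  unfolding S_def[abs_def] by (intro Cinf_on_scaleR open_N Cinf_inverse_\<sigma> Cinf_X)

lemma Cinf_H: "Cinf_on N H"
  unfolding H_def[abs_def] by (intro Cinf_on_scaleR open_N Cinf_inverse_\<sigma> Cinf_Dx Cinf_S)

lemma Cinf_NH: "Cinf_on N NH"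
  unfolding NH_def[abs_def] by (intro Cinf_on_scaleR open_N Cinf_inverse_\<sigma> Cinf_Dx Cinf_H)

lemma Cinf_\<nu>: "Cinf_on N \<nu>"
  unfolding \<nu>_def[abs_def]
  by (intro Cinf_on_add Cinf_on_mult open_N Cinf_on_const Cinf_ip Cinf_H Cinf_S
      Cinf_field[OF Cinf_bilinear_metric_dt])

lemma X_eq: "z \<in> N \<Longrightarrow> X z = \<sigma> z *\<^sub>R S z"
  and DxS_eq: "z \<in> N \<Longrightarrow> Dx S z = \<sigma> z *\<^sub>R H z"
  and DxH_eq: "z \<in> N \<Longrightarrow> Dx H z = \<sigma> z *\<^sub>R NH z"
  using \<sigma>_pos[of z] by (simp_all add: S_def H_def NH_def)

section \<open>Leibniz rules and commutation of covariant derivatives along the curves\<close>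

lemma dird_q:
  assumes z: "z \<in> N"
  shows "dird (1, 0) q z = (X z, 0)" "dird (0, 1) q z = (E z, 1)"
proof -
  have "(q has_derivative (\<lambda>v. (dird v Y z, snd v))) (at z)"
    unfolding q_def[abs_def]
    by (intro has_derivative_Pair Cinf_on_has_derivative[OF smooth_Y z] has_derivative_snd has_derivative_ident)
  from dirdI[OF this] show "dird (1, 0) q z = (X z, 0)" "dird (0, 1) q z = (E z, 1)"
    by (simp_all add: X_def E_def)
qed

lemma dird_horizontal_vertical:
  "f differentiable at p \<Longrightarrow> dird (u, 1) f p = dird (u, 0) f p + dird (0, 1) f (p :: 'a \<times> real)"
  using linear_add[OF linear_dird, of f p "(u, 0)" "(0, 1)"] by simp

lemma dx_ip:
  assumes V: "Cinf_on N V" and W: "Cinf_on N W" and z: "z \<in> N"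
  shows "dird (1, 0) (ip V W) z = ip (Dx V) W z + ip V (Dx W) z"
  unfolding ip_def[abs_def] dird_field[OF metric V W z]
  by (simp add: dird_q[OF z] compatible q_in z Dx_def bilinear_ladd[OF bilinear_metric[OF q_in[OF z]]]
      bilinear_radd[OF bilinear_metric[OF q_in[OF z]]])

text \<open>The base point moves in the direction \<open>(E z, 1)\<close>. Its horizontal part is
  absorbed into \<open>Dt\<close> by compatibility, its vertical part changes the metric
  itself.\<close>

lemma dt_ip:
  assumes V: "Cinf_on N V" and W: "Cinf_on N W" and z: "z \<in> N"
  shows "dird (0, 1) (ip V W) z = metric_dt (q z) (V z) (W z) + ip (Dt V) W z + ip V (Dt W) z"
  unfolding ip_def[abs_def] dird_field[OF metric V W z]
  by (simp add: dird_q[OF z] dird_horizontal_vertical[OF differentiable_metric[OF q_in[OF z]], of "E z"]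
      metric_dt_def compatible q_in z Dt_def bilinear_ladd[OF bilinear_metric[OF q_in[OF z]]]
      bilinear_radd[OF bilinear_metric[OF q_in[OF z]]])

text \<open>Symmetry of the second derivatives of \<open>Y\<close> together with vanishing
  torsion.\<close>

lemma Dx_E: "z \<in> N \<Longrightarrow> Dx E z = Dt X z"
  using dird_commute[OF smooth_Y open_N, of z "(1, 0)" "(0, 1)"]
    torsion_free[OF q_in, of z "X z" "E z"]
  by (simp add: Dx_def Dt_def X_def E_def)

lemma Dx_scaleR:
  assumes f: "Cinf_on N f" and V: "Cinf_on N V" and z: "z \<in> N"
  shows "Dx (\<lambda>z. f z *\<^sub>R V z) z = dird (1, 0) f z *\<^sub>R V z + f z *\<^sub>R Dx V z"
  by (simp add: Dx_def dird_scaleR[OF Cinf_on_differentiable[OF f z] Cinf_on_differentiable[OF V z]]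
      bilinear_rmul[OF bilinear_connection[OF q_in[OF z]]] scaleR_add_right)

lemma Dt_scaleR:
  assumes f: "Cinf_on N f" and V: "Cinf_on N V" and z: "z \<in> N"
  shows "Dt (\<lambda>z. f z *\<^sub>R V z) z = dird (0, 1) f z *\<^sub>R V z + f z *\<^sub>R Dt V z"
  by (simp add: Dt_def dird_scaleR[OF Cinf_on_differentiable[OF f z] Cinf_on_differentiable[OF V z]]
      bilinear_rmul[OF bilinear_connection[OF q_in[OF z]]] scaleR_add_right)

lemma Dx_add:
  assumes V: "Cinf_on N V" and W: "Cinf_on N W" and z: "z \<in> N"
  shows "Dx (\<lambda>z. V z + W z) z = Dx V z + Dx W z"
  by (simp add: Dx_def dird_add[OF Cinf_on_differentiable[OF V z] Cinf_on_differentiable[OF W z]]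
      bilinear_radd[OF bilinear_connection[OF q_in[OF z]]])

lemma Dt_cong:
  assumes "z \<in> N" "\<And>z. z \<in> N \<Longrightarrow> V z = W z"
  shows "Dt V z = Dt W z"
  using dird_cong[OF open_N assms] by (simp add: Dt_def assms)

text \<open>The mixed second derivatives of \<open>V\<close> and of \<open>Y\<close> cancel. What
  remains are derivatives and products of \<open>\<Gamma>\<close>; the time derivative of
  \<open>\<Gamma>\<close> enters because the base point also moves in \<open>t\<close>.\<close>

lemma Dt_Dx:
  assumes V: "Cinf_on N V" and z: "z \<in> N"
  shows "Dt (Dx V) z = Dx (Dt V) z + curv (q z) (E z) (X z) (V z)"
proof -
  note bil = bilinear_connection[OF q_in[OF z]]
  note field = Cinf_field[OF connection]
  have "dird (0, 1) (Dx V) z = dird (0, 1) (dird (1, 0) V) z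
      + (dird (E z, 1) (\<lambda>p. \<Gamma> p (X z) (V z)) (q z) + \<Gamma> (q z) (dird (0, 1) X z) (V z)
      + \<Gamma> (q z) (X z) (dird (0, 1) V z))"
    unfolding Dx_def[abs_def]
    by (simp add: dird_add Cinf_on_differentiable[OF Cinf_on_dird[OF V] z]
        Cinf_on_differentiable[OF field[OF Cinf_X V] z]
        dird_field[OF connection Cinf_X V z] dird_q[OF z])
  moreover have "dird (1, 0) (Dt V) z = dird (1, 0) (dird (0, 1) V) z
      + (dird (X z, 0) (\<lambda>p. \<Gamma> p (E z) (V z)) (q z) + \<Gamma> (q z) (dird (1, 0) E z) (V z)
      + \<Gamma> (q z) (E z) (dird (1, 0) V z))"
    unfolding Dt_def[abs_def]
    by (simp add: dird_add Cinf_on_differentiable[OF Cinf_on_dird[OF V] z]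
        Cinf_on_differentiable[OF field[OF Cinf_E V] z]
        dird_field[OF connection Cinf_E V z] dird_q[OF z])
  moreover have "dird (0, 1) X z = dird (1, 0) E z"
    unfolding X_def E_def by (rule dird_commute[OF smooth_Y open_N z])
  moreover have "dird (0, 1) (dird (1, 0) V) z = dird (1, 0) (dird (0, 1) V) z"
    by (rule dird_commute[OF V open_N z])
  ultimately show ?thesis
    by (simp add: Dx_def[of "Dt V"] Dt_def[of "Dx V"] Dx_def[of V] Dt_def[of V] curv_def
        bilinear_radd[OF bil])
qed

section \<open>Orthogonality relations and arc-length derivatives\<close>

lemma ip_SS: assumes z: "z \<in> N" shows "ip S S z = 1"
proof -
  have "ip S S z = inverse (\<sigma> z) * (inverse (\<sigma> z) * (\<sigma> z * \<sigma> z))"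
    unfolding \<sigma>_square[OF z] using bilinear_metric[OF q_in[OF z]]
    by (simp add: ip_def S_def bilinear_lmul bilinear_rmul)
  then show ?thesis using \<sigma>_pos[OF z] by (simp add: field_simps)
qed

lemma ip_commute: "z \<in> N \<Longrightarrow> ip V W z = ip W V z"
  by (simp add: ip_def metric_sym[OF q_in])

lemma ip_X: "z \<in> N \<Longrightarrow> ip X W z = \<sigma> z * ip S W z"
  and ip_DxS: "z \<in> N \<Longrightarrow> ip (Dx S) W z = \<sigma> z * ip H W z"
  and ip_DxH: "z \<in> N \<Longrightarrow> ip (Dx H) W z = \<sigma> z * ip NH W z"
  using bilinear_lmul[OF bilinear_metric[OF q_in], of z "\<sigma> z"]
  by (simp_all add: ip_def X_eq DxS_eq DxH_eq)

lemma ip_HS: assumes z: "z \<in> N" shows "ip H S z = 0"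
proof -
  have "dird (1, 0) (ip S S) z = dird (1, 0) (\<lambda>_. 1) z"
    by (rule dird_cong[OF open_N z ip_SS])
  then have "ip (Dx S) S z = 0"
    using dx_ip[OF Cinf_S Cinf_S z] ip_commute[OF z, of S "Dx S"] by (simp add: dird_const)
  then show ?thesis
    using ip_DxS[OF z, of S] \<sigma>_pos[OF z] by simp
qed

text \<open>Differentiates \<open>ip H S = 0\<close>. This determines the tangential part of
  \<open>NH\<close>, both for the change of speed and for the projection orthogonal to
  \<open>X\<close>.\<close>

lemma ip_NHS: assumes z: "z \<in> N" shows "ip NH S z = - ip H H z"
proof -
  have "dird (1, 0) (ip H S) z = dird (1, 0) (\<lambda>_. 0) z"
    by (rule dird_cong[OF open_N z ip_HS])
  then have "ip (Dx H) S z + ip (Dx S) H z = 0"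
    using dx_ip[OF Cinf_H Cinf_S z] ip_commute[OF z, of H "Dx S"] by (simp add: dird_const)
  then have "\<sigma> z * (ip NH S z + ip H H z) = 0"
    unfolding ip_DxS[OF z, of H] ip_DxH[OF z, of S]
    by (simp add: algebra_simps)
  then show ?thesis using \<sigma>_pos[OF z] by simp
qed

lemma dx_kk: assumes z: "z \<in> N" shows "dird (1, 0) (ip H H) z = 2 * \<sigma> z * ip NH H z"
  using dx_ip[OF Cinf_H Cinf_H z] ip_commute[OF z, of H "Dx H"] ip_DxH[OF z, of H]
  by simp

text \<open>Only the inner derivative is divided by the speed, so this is \<open>\<sigma>\<close>
  times the second arc-length derivative.\<close>

lemma dds_kk:
  assumes z: "z \<in> N"
  shows "dird (1, 0) (\<lambda>z. dird (1, 0) (ip H H) z / \<sigma> z) z = 2 * ip (Dx NH) H z + 2 * \<sigma> z * ip NH NH z"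
proof -
  have "dird (1, 0) (\<lambda>z. dird (1, 0) (ip H H) z / \<sigma> z) z = dird (1, 0) (\<lambda>z. 2 * ip NH H z) z"
    by (rule dird_cong[OF open_N z]) (use dx_kk \<sigma>_pos in force)
  also have "\<dots> = 2 * dird (1, 0) (ip NH H) z"
    by (rule dird_bounded_linear[OF bounded_linear_mult_right
          Cinf_on_differentiable[OF Cinf_ip[OF Cinf_NH Cinf_H] z]])
  also have "\<dots> = 2 * ip (Dx NH) H z + 2 * \<sigma> z * ip NH NH z"
    using dx_ip[OF Cinf_NH Cinf_H z] ip_commute[OF z, of NH "Dx H"] ip_DxH[OF z, of NH]
    by simp
  finally show ?thesis .
qed

section \<open>Evolution of the squared curvature on a time slice where the curve-shrinking equation
  holds\<close>

context
  fixes J :: "real set" and t :: real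
  assumes J: "open J" "\<And>\<xi>. \<xi> \<in> J \<Longrightarrow> (\<xi>, t) \<in> N"
    and shrinking: "\<And>\<xi>. \<xi> \<in> J \<Longrightarrow> E (\<xi>, t) = H (\<xi>, t)"
begin

text \<open>\<open>Dx\<close> only sees the slice, so equations known for the single time
  \<open>t\<close>, such as \<open>shrinking\<close> and \<open>DtS\<close>, may be differentiated
  along the curve.\<close>

lemma Dx_cong_line:
  assumes "\<xi> \<in> J" "Cinf_on N V" "Cinf_on N W" "\<And>\<xi>. \<xi> \<in> J \<Longrightarrow> V (\<xi>, t) = W (\<xi>, t)"
  shows "Dx V (\<xi>, t) = Dx W (\<xi>, t)"
  using dird_line_eq[OF Cinf_on_differentiable[OF assms(2) J(2)[OF assms(1)]]
      Cinf_on_differentiable[OF assms(3) J(2)[OF assms(1)]] assms(1) J(1) assms(4)]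
  by (simp add: Dx_def assms(1,4))

lemma DtX:
  assumes \<xi>: "\<xi> \<in> J" shows "Dt X (\<xi>, t) = \<sigma> (\<xi>, t) *\<^sub>R NH (\<xi>, t)"
  using Dx_cong_line[OF \<xi> Cinf_E Cinf_H shrinking] Dx_E[OF J(2)[OF \<xi>]] DxH_eq[OF J(2)[OF \<xi>]] by simp

text \<open>Differentiates \<open>\<sigma> * \<sigma> = ip X X\<close> in time; by
  \<open>DtX\<close> and \<open>ip_NHS\<close> the inner product of \<open>Dt X\<close> with
  \<open>X\<close> is \<open>- \<sigma>\<^sup>2\<close> times \<open>ip H H\<close>.\<close>

lemma dt_\<sigma>:
  assumes \<xi>: "\<xi> \<in> J" shows "dird (0, 1) \<sigma> (\<xi>, t) = \<sigma> (\<xi>, t) * \<nu> (\<xi>, t)"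
proof -
  define z where "z = (\<xi>, t)"
  have z: "z \<in> N" using J(2)[OF \<xi>] by (simp add: z_def)
  note bil = bilinear_metric_dt[OF q_in[OF z]]
  have "2 * \<sigma> z * dird (0, 1) \<sigma> z = dird (0, 1) (\<lambda>z. \<sigma> z * \<sigma> z) z"
    by (simp add: dird_mult Cinf_on_differentiable[OF Cinf_\<sigma> z])
  also have "\<dots> = dird (0, 1) (ip X X) z"
    by (rule dird_cong[OF open_N z \<sigma>_square])
  also have "\<dots> = metric_dt (q z) (X z) (X z) + 2 * ip (Dt X) X z"
    using dt_ip[OF Cinf_X Cinf_X z] ip_commute[OF z, of X "Dt X"] by simp
  also have "ip (Dt X) X z = \<sigma> z * ip NH X z"
    using DtX[OF \<xi>] bilinear_lmul[OF bilinear_metric[OF q_in[OF z]]] by (simp add: ip_def z_def[symmetric])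
  also have "ip NH X z = \<sigma> z * ip NH S z"
    using ip_X[OF z, of NH] ip_commute[OF z, of NH] by simp
  also have "metric_dt (q z) (X z) (X z) = \<sigma> z * \<sigma> z * metric_dt (q z) (S z) (S z)"
    by (simp add: X_eq[OF z] bilinear_lmul[OF bil] bilinear_rmul[OF bil])
  finally have "2 * \<sigma> z * dird (0, 1) \<sigma> z = 2 * \<sigma> z * (\<sigma> z * \<nu> z)"
    by (simp add: ip_NHS[OF z] \<nu>_def algebra_simps)
  then show ?thesis using \<sigma>_pos[OF z] by (simp add: z_def)
qed

text \<open>Differentiates \<open>X = \<sigma> S\<close> in time and divides by the speed.\<close>

lemma DtS:
  assumes \<xi>: "\<xi> \<in> J" shows "Dt S (\<xi>, t) = NH (\<xi>, t) + (- \<nu> (\<xi>, t)) *\<^sub>R S (\<xi>, t)"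
proof -
  define z where "z = (\<xi>, t)"
  have z: "z \<in> N" using J(2)[OF \<xi>] by (simp add: z_def)
  have "\<sigma> z *\<^sub>R NH z = Dt (\<lambda>z. \<sigma> z *\<^sub>R S z) z"
    using DtX[OF \<xi>] Dt_cong[OF z X_eq] by (simp add: z_def)
  also have "\<dots> = (\<sigma> z * \<nu> z) *\<^sub>R S z + \<sigma> z *\<^sub>R Dt S z"
    using Dt_scaleR[OF Cinf_\<sigma> Cinf_S z] dt_\<sigma>[OF \<xi>] by (simp add: z_def)
  finally have "\<sigma> z *\<^sub>R (NH z - \<nu> z *\<^sub>R S z - Dt S z) = 0"
    by (simp add: algebra_simps)
  then have "NH z - \<nu> z *\<^sub>R S z - Dt S z = 0"
    using \<sigma>_pos[OF z] by simp
  then show ?thesis by (simp add: z_def algebra_simps)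
qed

text \<open>\<open>Dt (Dx S)\<close> is computed in two ways: as the time derivative of
  \<open>\<sigma> H\<close>, and as \<open>Dx (Dt S)\<close> plus curvature, where
  \<open>DtS\<close> is inserted. The inner product with \<open>H\<close> is then solved for
  \<open>ip (Dt H) H\<close>.\<close>

lemma ip_DtH:
  assumes \<xi>: "\<xi> \<in> J" and z_def: "z = (\<xi>, t)"
  shows "ip (Dt H) H z = - 2 * \<nu> z * ip H H z + ip (Dx NH) H z / \<sigma> z
    + G (q z) (curv (q z) (H z) (S z) (S z)) (H z)"
proof -
  have z: "z \<in> N" using J(2)[OF \<xi>] by (simp add: z_def)
  note bil = bilinear_metric[OF q_in[OF z]]
  have neg: "Cinf_on N (\<lambda>z. - \<nu> z)"
    using Cinf_on_mult[OF open_N Cinf_on_const[of N "- 1"] Cinf_\<nu>] by simp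
  have "Dx (Dt S) z = Dx (\<lambda>z. NH z + (- \<nu> z) *\<^sub>R S z) z"
    unfolding z_def
    by (rule Dx_cong_line[OF \<xi> Cinf_Dt[OF Cinf_S]])
       (use DtS Cinf_on_add[OF open_N Cinf_NH Cinf_on_scaleR[OF open_N neg Cinf_S]] in simp_all)
  also have "\<dots> = Dx NH z + (dird (1, 0) (\<lambda>z. - \<nu> z) z *\<^sub>R S z + (- \<nu> z) *\<^sub>R \<sigma> z *\<^sub>R H z)"
    by (simp only: Dx_add[OF Cinf_NH Cinf_on_scaleR[OF open_N neg Cinf_S] z]
        Dx_scaleR[OF neg Cinf_S z] DxS_eq[OF z])
  finally have DxDtS: "Dx (Dt S) z = Dx NH z
     + (dird (1, 0) (\<lambda>z. - \<nu> z) z *\<^sub>R S z + (- \<nu> z) *\<^sub>R \<sigma> z *\<^sub>R H z)" .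
  have "(\<sigma> z * \<nu> z) *\<^sub>R H z + \<sigma> z *\<^sub>R Dt H z = Dt (\<lambda>z. \<sigma> z *\<^sub>R H z) z"
    using Dt_scaleR[OF Cinf_\<sigma> Cinf_H z] dt_\<sigma>[OF \<xi>] by (simp add: z_def)
  also have "\<dots> = Dt (Dx S) z"
    by (rule Dt_cong[OF z DxS_eq[symmetric]])
  also have "\<dots> = Dx (Dt S) z + \<sigma> z *\<^sub>R curv (q z) (H z) (S z) (S z)"
    unfolding Dt_Dx[OF Cinf_S z]
    using shrinking[OF \<xi>] by (simp add: z_def[symmetric] X_eq[OF z] curv_scaleR[OF q_in[OF z]])
  finally have "G (q z) ((\<sigma> z * \<nu> z) *\<^sub>R H z + \<sigma> z *\<^sub>R Dt H z) (H z)
     = G (q z) (Dx (Dt S) z + \<sigma> z *\<^sub>R curv (q z) (H z) (S z) (S z)) (H z)"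
    by simp
  then have "\<sigma> z * \<nu> z * ip H H z + \<sigma> z * ip (Dt H) H z
    = ip (Dx NH) H z - \<nu> z * \<sigma> z * ip H H z + \<sigma> z * G (q z) (curv (q z) (H z) (S z) (S z)) (H z)"
    \<comment> \<open>The derivative of \<open>\<nu>\<close> occurs only as a coefficient of
      \<open>S\<close>, which is orthogonal to \<open>H\<close>.\<close>
    unfolding DxDtS using ip_HS[OF z] ip_commute[OF z, of S H]
    by (simp add: ip_def bilinear_ladd[OF bil] bilinear_lmul[OF bil] bilinear_lneg[OF bil]
        bilinear_lsub[OF bil] algebra_simps)
  then show ?thesis using \<sigma>_pos[OF z] by (simp add: field_simps)
qed

text \<open>The term \<open>- 4 \<nu>\<close> times \<open>ip H H\<close> splits into the quartic
  term and the one with \<open>metric_dt\<close> on \<open>S\<close>; \<open>dds_kk\<close> replaces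
  \<open>Dx NH\<close> by the second derivative and the square of \<open>NH\<close>.\<close>

theorem dt_kk:
  assumes \<xi>: "\<xi> \<in> J" and z_def: "z = (\<xi>, t)"
  shows "dird (0, 1) (ip H H) z = dird (1, 0) (\<lambda>z. dird (1, 0) (ip H H) z / \<sigma> z) z / \<sigma> z
     - 2 * ip NH NH z + 4 * (ip H H z)\<^sup>2
     + metric_dt (q z) (H z) (H z) - 2 * ip H H z * metric_dt (q z) (S z) (S z)
     + 2 * G (q z) (curv (q z) (H z) (S z) (S z)) (H z)"
proof -
  have z: "z \<in> N" using J(2)[OF \<xi>] by (simp add: z_def)
  have "dird (0, 1) (ip H H) z = metric_dt (q z) (H z) (H z) + 2 * ip (Dt H) H z"
    using dt_ip[OF Cinf_H Cinf_H z] ip_commute[OF z, of H "Dt H"] by simp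
  then show ?thesis
    unfolding dds_kk[OF z] ip_DtH[OF \<xi> z_def] using \<sigma>_pos[OF z]
    by (simp add: \<nu>_def field_simps power2_eq_square)
qed

end

end


section \<open>The metric \<open>g(t) + dt\<^sup>2\<close>\<close>

text \<open>The condition along coordinate directions under which a derivative within
  \<open>D\<close> is unique. It covers the end times of the slab, where the set is not
  open.\<close>

definition approachable :: "'a::euclidean_space set \<Rightarrow> 'a \<Rightarrow> bool" where
  "approachable D p \<longleftrightarrow> (\<forall>i\<in>Basis. \<forall>e>0. \<exists>d. 0 < \<bar>d\<bar> \<and> \<bar>d\<bar> < e \<and> p + d *\<^sub>R i \<in> D)"

lemma approachable_open:
  assumes "open D" "p \<in> D"
  shows "approachable D p"
  unfolding approachable_def
proof (intro ballI allI impI)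
  fix i :: 'a and e :: real assume i: "i \<in> Basis" and "e > 0"
  obtain r where r: "r > 0" "ball p r \<subseteq> D" using assms openE by blast
  have "p + (min r e / 2) *\<^sub>R i \<in> ball p r"
    using i r(1) \<open>e > 0\<close> by (auto simp: dist_norm)
  then show "\<exists>d. 0 < \<bar>d\<bar> \<and> \<bar>d\<bar> < e \<and> p + d *\<^sub>R i \<in> D"
    using r \<open>e > 0\<close> by (intro exI[of _ "min r e / 2"]) auto
qed

lemma approachable_slab:
  fixes W :: "'a::euclidean_space set"
  assumes "open W" "y \<in> W" "0 < T" "t \<in> {0..T::real}"
  shows "approachable (W \<times> {0..T}) (y, t)"
  unfolding approachable_def
proof (intro ballI allI impI)
  fix i :: "'a \<times> real" and e :: real assume i: "i \<in> Basis" and "e > 0"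
  consider j where "j \<in> Basis" "i = (j, 0)" | "i = (0, 1)"
    using i by (auto simp: Basis_prod_def)
  then show "\<exists>d. 0 < \<bar>d\<bar> \<and> \<bar>d\<bar> < e \<and> (y, t) + d *\<^sub>R i \<in> W \<times> {0..T}"
  proof cases
    case 1
    then show ?thesis
      using approachable_open[OF assms(1,2)] assms(4) \<open>e > 0\<close> unfolding approachable_def by fastforce
  next
    case 2
    \<comment> \<open>The step points into the interval: backwards in time at \<open>t = T\<close>,
      forwards otherwise.\<close>
    define d where "d = (if t = T then - min T e / 2 else min (T - t) e / 2)"
    have "0 < \<bar>d\<bar> \<and> \<bar>d\<bar> < e \<and> t + d \<in> {0..T}"
      using assms(3,4) \<open>e > 0\<close> by (auto simp: d_def min_def field_simps)
    then show ?thesis using 2 assms(2) by auto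
  qed
qed

text \<open>The bridge from derivatives within a set to ordinary ones: near \<open>p\<close> the
  function may be replaced by an extension that is differentiable at \<open>p\<close>.\<close>

lemma dderiv_eqI:
  fixes f :: "'a::euclidean_space \<Rightarrow> 'b::real_normed_vector"
  assumes D: "approachable D p" "p \<in> D" and U: "open U" "p \<in> U"
    and eq: "\<And>q. q \<in> U \<inter> D \<Longrightarrow> f q = f' q" and f': "f' differentiable at p"
  shows "dderiv D f p v = dird v f' p"
proof -
  have f'D: "(f' has_derivative (\<lambda>v. dird v f' p)) (at p within D)"
    by (rule has_derivative_at_withinI[OF has_derivative_dird[OF f']])
  obtain e where "e > 0" "ball p e \<subseteq> U" using U openE by blast
  then have f: "(f has_derivative (\<lambda>v. dird v f' p)) (at p within D)"
    using eq by (intro has_derivative_transform_within[OF f'D \<open>e > 0\<close> \<open>p \<in> D\<close>])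
      (simp add: dist_commute subset_iff)
  have "frechet_derivative f (at p within D) = (\<lambda>v. dird v f' p)"
    by (rule frechet_derivative_unique_within[OF _ f])
       (use D(1) differentiableI[OF f] in \<open>auto simp: approachable_def frechet_derivative_works[symmetric]\<close>)
  then show ?thesis by (simp add: dderiv_def)
qed

text \<open>Uniqueness is the Koszul formula: compatibility and symmetry determine all
  \<open>G p (\<Gamma> u v) w\<close>.\<close>

lemma christoffel_eqI:
  assumes G: "bilinear (G p)" "\<And>u v. G p u v = G p v u" "\<And>z. (\<And>w. G p z w = 0) \<Longrightarrow> z = 0"
    and \<Gamma>: "bilinear \<Gamma>" "\<And>u v. \<Gamma> u v = \<Gamma> v u"
      "\<And>u v w. dderiv W (\<lambda>q. G q v w) p u = G p (\<Gamma> u v) w + G p v (\<Gamma> u w)"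
  shows "christoffel W G p = \<Gamma>"
  unfolding christoffel_def
proof (rule the_equality, intro conjI allI \<Gamma>)
  fix \<Gamma>' assume \<Gamma>': "bilinear \<Gamma>' \<and> (\<forall>u v. \<Gamma>' u v = \<Gamma>' v u) \<and>
     (\<forall>u v w. dderiv W (\<lambda>q. G q v w) p u = G p (\<Gamma>' u v) w + G p v (\<Gamma>' u w))"
  have koszul: "2 * G p (\<Delta> u v) w = dderiv W (\<lambda>q. G q v w) p u + dderiv W (\<lambda>q. G q u w) p v
      - dderiv W (\<lambda>q. G q u v) p w"
    if "\<And>u v. \<Delta> u v = \<Delta> v u"
      "\<And>u v w. dderiv W (\<lambda>q. G q v w) p u = G p (\<Delta> u v) w + G p v (\<Delta> u w)" for \<Delta> u v w
    unfolding that(2) using that(1)[of v u] that(1)[of w u] that(1)[of w v] G(2) by simp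
  have "2 * G p (\<Gamma>' u v) w = 2 * G p (\<Gamma> u v) w" for u v w
    using koszul[of \<Gamma>' u v w] \<Gamma>' by (simp add: koszul[OF \<Gamma>(2,3), of u v w])
  then have "\<Gamma>' u v - \<Gamma> u v = 0" for u v
    by (intro G(3)) (simp add: bilinear_lsub[OF G(1)])
  then show "\<Gamma>' = \<Gamma>" by (intro ext) simp
qed

text \<open>\<open>R p\<close> is the inverse of the metric at \<open>p\<close>, turning the
  functional \<open>(\<bullet>) a\<close> into a vector. Its smoothness makes the connection below
  smooth, and its existence makes \<open>G p\<close> nondegenerate.\<close>

locale raised_metric =
  fixes \<Omega> :: "('a::euclidean_space \<times> real) set"
    and G :: "'a \<times> real \<Rightarrow> 'a \<Rightarrow> 'a \<Rightarrow> real"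
    and R :: "'a \<times> real \<Rightarrow> 'a \<Rightarrow> 'a"
  assumes open_dom: "open \<Omega>"
    and metric: "Cinf_bilinear \<Omega> G"
    and metric_sym: "p \<in> \<Omega> \<Longrightarrow> G p u v = G p v u"
    and Cinf_raise: "Cinf_on \<Omega> (\<lambda>p. R p a)"
    and metric_raise: "p \<in> \<Omega> \<Longrightarrow> G p (R p a) w = a \<bullet> w"
begin

section \<open>Existence of the connection of the slices by the Koszul formula\<close>

definition sharp :: "'a \<times> real \<Rightarrow> ('a \<Rightarrow> real) \<Rightarrow> 'a" where
  "sharp p \<phi> = (\<Sum>e\<in>Basis. \<phi> e *\<^sub>R R p e)"

text \<open>The Koszul expression on constant fields, whose brackets vanish; again a sum with a
  negative coefficient, for the closure rules of \<open>Cinf_on\<close>.\<close>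

definition koszul :: "'a \<times> real \<Rightarrow> 'a \<Rightarrow> 'a \<Rightarrow> 'a \<Rightarrow> real" where
  "koszul p u v w = (1 / 2) * dird (u, 0) (\<lambda>p. G p v w) p + (1 / 2) * dird (v, 0) (\<lambda>p. G p u w) p
     + (- 1 / 2) * dird (w, 0) (\<lambda>p. G p u v) p"

definition \<Gamma> :: "'a \<times> real \<Rightarrow> 'a \<Rightarrow> 'a \<Rightarrow> 'a" where
  "\<Gamma> p u v = sharp p (koszul p u v)"

lemma bilinear_metric: "p \<in> \<Omega> \<Longrightarrow> bilinear (G p)"
  using metric by (simp add: Cinf_bilinear_def)

lemma Cinf_metric: "Cinf_on \<Omega> (\<lambda>p. G p u v)"
  using metric by (simp add: Cinf_bilinear_def)

lemma metric_sharp: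
  assumes "p \<in> \<Omega>" "linear \<phi>"
  shows "G p (sharp p \<phi>) w = \<phi> w"
proof -
  interpret \<phi>: linear \<phi> by fact
  interpret G: linear "\<lambda>z. G p z w"
    using bilinear_metric[OF assms(1)] by (simp add: bilinear_def)
  have "G p (sharp p \<phi>) w = (\<Sum>e\<in>Basis. \<phi> e * (e \<bullet> w))"
    by (simp add: sharp_def G.sum G.scale metric_raise[OF assms(1)])
  also have "\<dots> = \<phi> (\<Sum>e\<in>Basis. (w \<bullet> e) *\<^sub>R e)"
    by (simp add: \<phi>.sum \<phi>.scale inner_commute mult.commute)
  finally show ?thesis by (simp add: euclidean_representation)
qed

text \<open>Testing against \<open>w = R p z\<close> gives \<open>z \<bullet> z = 0\<close>.\<close>

lemma nondegenerate:
  assumes "p \<in> \<Omega>" "\<And>w. G p z w = 0"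
  shows "z = 0"
  using metric_raise[OF assms(1), of z z] assms(2)[of "R p z"] metric_sym[OF assms(1), of z] by simp

lemma Cinf_sharp:
  assumes "\<And>e. Cinf_on \<Omega> (\<lambda>p. \<phi> p e)"
  shows "Cinf_on \<Omega> (\<lambda>p. sharp p (\<phi> p))"
  unfolding sharp_def by (intro Cinf_on_sum Cinf_on_scaleR open_dom assms Cinf_raise)

lemma sharp_add: "sharp p (\<lambda>w. \<phi> w + \<psi> w) = sharp p \<phi> + sharp p \<psi>"
  by (simp add: sharp_def scaleR_add_left sum.distrib)

lemma sharp_scaleR: "sharp p (\<lambda>w. c * \<phi> w) = c *\<^sub>R sharp p \<phi>"
  by (simp add: sharp_def scaleR_sum_right)

lemma bilinear_dird_metric: "p \<in> \<Omega> \<Longrightarrow> bilinear (\<lambda>u v. dird \<zeta> (\<lambda>p. G p u v) p)"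
  using Cinf_bilinear_dird[OF metric open_dom] by (simp add: Cinf_bilinear_def)

lemma linear_dird_metric:
  assumes "p \<in> \<Omega>" shows "linear (\<lambda>u. dird (u, 0) (\<lambda>p. G p v w) p)"
proof (rule linearI)
  note lin = linear_dird[OF Cinf_on_differentiable[OF Cinf_metric assms]]
  show "dird (a + b, 0) (\<lambda>p. G p v w) p = dird (a, 0) (\<lambda>p. G p v w) p + dird (b, 0) (\<lambda>p. G p v w) p" for a b
    using linear_add[OF lin, of "(a, 0)" "(b, 0)"] by simp
  show "dird (c *\<^sub>R a, 0) (\<lambda>p. G p v w) p = c *\<^sub>R dird (a, 0) (\<lambda>p. G p v w) p" for c a
    using linear_scale[OF lin, of c "(a, 0)"] by simp
qed

lemma koszul_sym: "p \<in> \<Omega> \<Longrightarrow> koszul p u v w = koszul p v u w"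
  using dird_cong[OF open_dom _ metric_sym, where v = "(w, 0)"] by (simp add: koszul_def)

lemma koszul_linear:
  assumes p: "p \<in> \<Omega>"
  shows "koszul p (u + u') v w = koszul p u v w + koszul p u' v w"
    "koszul p (c *\<^sub>R u) v w = c * koszul p u v w"
    "linear (koszul p u v)"
proof -
  note bil = bilinear_dird_metric[OF p]
  show 1: "koszul p (u + u') v w = koszul p u v w + koszul p u' v w"
    by (simp add: koszul_def bilinear_ladd[OF bil] linear_add[OF linear_dird_metric[OF p]] algebra_simps)
  show 2: "koszul p (c *\<^sub>R u) v w = c * koszul p u v w"
    by (simp add: koszul_def bilinear_lmul[OF bil] linear_scale[OF linear_dird_metric[OF p]] algebra_simps)
  show "linear (koszul p u v)"
    by (rule linearI)
      (simp_all add: koszul_def bilinear_radd[OF bil] bilinear_rmul[OF bil]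
        linear_add[OF linear_dird_metric[OF p]] linear_scale[OF linear_dird_metric[OF p]] algebra_simps)
qed

lemma \<Gamma>_sym: "p \<in> \<Omega> \<Longrightarrow> \<Gamma> p u v = \<Gamma> p v u"
  by (simp add: \<Gamma>_def sharp_def koszul_sym)

lemma Cinf_bilinear_\<Gamma>: "Cinf_bilinear \<Omega> \<Gamma>"
  unfolding Cinf_bilinear_def
proof (intro conjI ballI allI)
  fix p assume p: "p \<in> \<Omega>"
  have l: "\<Gamma> p (u + u') v = \<Gamma> p u v + \<Gamma> p u' v" "\<Gamma> p (c *\<^sub>R u) v = c *\<^sub>R \<Gamma> p u v" for c u u' v
    by (simp_all add: \<Gamma>_def sharp_def koszul_linear(1,2)[OF p] scaleR_add_left sum.distrib scaleR_sum_right)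
  \<comment> \<open>Symmetry moves a sum or multiple from the second argument to the first, where
    \<open>l\<close> applies; the instances are restricted to these shapes and full symmetry is used
    only afterwards.\<close>
  show "bilinear (\<Gamma> p)"
    unfolding bilinear_def
    by (intro conjI allI linearI) (simp_all add: l \<Gamma>_sym[OF p, of _ "_ + _"] \<Gamma>_sym[OF p, of _ "_ *\<^sub>R _"], simp_all add: \<Gamma>_sym[OF p])
next
  fix u v
  show "Cinf_on \<Omega> (\<lambda>p. \<Gamma> p u v)"
    unfolding \<Gamma>_def koszul_def
    by (intro Cinf_sharp Cinf_on_add Cinf_on_mult Cinf_on_const open_dom Cinf_on_dird Cinf_metric)
qed

text \<open>In the sum of the Koszul expressions for \<open>u v w\<close> and \<open>u w v\<close>
  the derivatives in the directions \<open>v\<close> and \<open>w\<close> cancel, which is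
  compatibility.\<close>

sublocale metric_connection \<Omega> G \<Gamma>
proof
  fix p u v w assume p: "p \<in> \<Omega>"
  have "G p (\<Gamma> p u v) w = koszul p u v w" "G p (\<Gamma> p u w) v = koszul p u w v"
    unfolding \<Gamma>_def by (rule metric_sharp[OF p koszul_linear(3)[OF p]])+
  moreover have "G p v (\<Gamma> p u w) = G p (\<Gamma> p u w) v" by (rule metric_sym[OF p])
  moreover have "dird (u, 0) (\<lambda>p. G p w v) p = dird (u, 0) (\<lambda>p. G p v w) p"
    by (rule dird_cong[OF open_dom p metric_sym])
  ultimately show "dird (u, 0) (\<lambda>p. G p v w) p = G p (\<Gamma> p u v) w + G p v (\<Gamma> p u w)"
    by (simp add: koszul_def field_simps)
qed (use open_dom metric metric_sym \<Gamma>_sym Cinf_bilinear_\<Gamma> in auto)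

text \<open>In the product metric this is the covariant derivative of the vertical field in the
  direction \<open>u\<close>, hence up to sign the shape operator of the time slices.\<close>

definition P :: "'a \<times> real \<Rightarrow> 'a \<Rightarrow> 'a" where
  "P p u = sharp p (\<lambda>w. (1 / 2) * metric_dt p u w)"

lemma Cinf_P: "Cinf_on \<Omega> (\<lambda>p. P p u)"
  unfolding P_def metric_dt_def
  by (intro Cinf_sharp Cinf_on_mult Cinf_on_const open_dom Cinf_on_dird Cinf_metric)

lemma metric_P: "p \<in> \<Omega> \<Longrightarrow> G p (P p u) w = metric_dt p u w / 2"
  unfolding P_def
  using bilinear_metric_dt[of p] by (subst metric_sharp)
    (auto simp: bilinear_radd bilinear_rmul algebra_simps intro!: linearI)

lemma metric_dt_sym: "p \<in> \<Omega> \<Longrightarrow> metric_dt p u v = metric_dt p v u"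
  unfolding metric_dt_def by (rule dird_cong[OF open_dom _ metric_sym])

lemma linear_P: "p \<in> \<Omega> \<Longrightarrow> linear (P p)"
  unfolding P_def using bilinear_metric_dt[of p]
  by (intro linearI)
     (simp_all add: bilinear_ladd bilinear_lmul sharp_add[symmetric] sharp_scaleR[symmetric] algebra_simps)

section \<open>The connection of the product metric\<close>

definition \<Gamma>hat :: "'a \<times> real \<Rightarrow> 'a \<times> real \<Rightarrow> 'a \<times> real \<Rightarrow> 'a \<times> real" where
  "\<Gamma>hat p U V = (\<Gamma> p (fst U) (fst V) + (snd U *\<^sub>R P p (fst V) + snd V *\<^sub>R P p (fst U)),
     (- 1 / 2) * metric_dt p (fst U) (fst V))"

lemma bilinear_\<Gamma>hat:
  assumes p: "p \<in> \<Omega>" shows "bilinear (\<Gamma>hat p)"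
proof -
  note lin = linear_add[OF linear_P[OF p]] linear_scale[OF linear_P[OF p]]
    bilinear_ladd[OF bilinear_metric_dt[OF p]] bilinear_lmul[OF bilinear_metric_dt[OF p]]
    bilinear_radd[OF bilinear_metric_dt[OF p]] bilinear_rmul[OF bilinear_metric_dt[OF p]]
    bilinear_ladd[OF bilinear_connection[OF p]] bilinear_lmul[OF bilinear_connection[OF p]]
    bilinear_radd[OF bilinear_connection[OF p]] bilinear_rmul[OF bilinear_connection[OF p]]
  show ?thesis
    unfolding bilinear_def
    by (intro conjI allI linearI) (simp_all add: \<Gamma>hat_def lin scaleR_add_left scaleR_add_right algebra_simps)
qed

lemma Cinf_\<Gamma>hat: "Cinf_on \<Omega> (\<lambda>p. \<Gamma>hat p U V)"
  unfolding \<Gamma>hat_def metric_dt_def using Cinf_bilinear_\<Gamma>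
  by (intro Cinf_on_Pair Cinf_on_add Cinf_on_scaleR Cinf_on_mult Cinf_on_const open_dom Cinf_P
      Cinf_on_dird Cinf_metric) (simp add: Cinf_bilinear_def)

end

text \<open>\<open>G\<close> extends the given family \<open>g\<close> beyond \<open>{0..T}\<close>.
  Derivatives of \<open>g\<close> within \<open>W\<close> or within the slab can therefore be
  computed as ordinary derivatives of \<open>G\<close>.\<close>

locale slab_metric = raised_metric +
  fixes W :: "'a set" and T :: real and g :: "real \<Rightarrow> 'a \<Rightarrow> 'a \<Rightarrow> 'a \<Rightarrow> real"
  assumes open_W: "open W" and T_pos: "0 < T"
    and dom_subset: "p \<in> \<Omega> \<Longrightarrow> fst p \<in> W"
    and extends: "p \<in> \<Omega> \<Longrightarrow> snd p \<in> {0..T} \<Longrightarrow> g (snd p) (fst p) = G p"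
begin

section \<open>Connections and curvature within the slab in terms of the extension\<close>

lemma horizontal_dderiv_eqI:
  fixes f :: "'a \<Rightarrow> 'b::real_normed_vector"
  assumes "(y, t) \<in> \<Omega>" "t \<in> {0..T}" "f' differentiable at (y, t)"
    and "\<And>y. (y, t) \<in> \<Omega> \<Longrightarrow> f y = f' (y, t)"
  shows "dderiv W f y u = dird (u, 0) f' (y, t)"
proof -
  have "((\<lambda>y. (y, t)) has_derivative (\<lambda>u. (u, 0))) (at y)"
    by (intro has_derivative_Pair has_derivative_ident has_derivative_const)
  from has_derivative_compose[OF this has_derivative_dird[OF assms(3)]]
  have d: "((\<lambda>y. f' (y, t)) has_derivative (\<lambda>u. dird (u, 0) f' (y, t))) (at y)" .
  have "open ((\<lambda>y. (y, t)) -` \<Omega>)"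
    by (intro open_vimage open_dom continuous_intros)
  then have "dderiv W f y u = dird u (\<lambda>y. f' (y, t)) y"
    using dom_subset[OF assms(1)] assms(1,4) differentiableI[OF d]
    by (intro dderiv_eqI[where U = "(\<lambda>y. (y, t)) -` \<Omega>"] approachable_open open_W) auto
  then show ?thesis using dirdI[OF d] by simp
qed

lemma slab_dderiv_eqI:
  fixes f :: "'a \<times> real \<Rightarrow> 'b::real_normed_vector"
  assumes "p \<in> \<Omega>" "snd p \<in> {0..T}" "f' differentiable at p"
    and "\<And>q. q \<in> \<Omega> \<Longrightarrow> snd q \<in> {0..T} \<Longrightarrow> f q = f' q"
  shows "dderiv (W \<times> {0..T}) f p v = dird v f' p"
  using approachable_slab[OF open_W dom_subset[OF assms(1)] T_pos assms(2)] dom_subset assms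
  by (intro dderiv_eqI[where U = \<Omega>] open_dom) (auto simp: mem_Times_iff)

lemma christoffel_slice:
  assumes p: "(y, t) \<in> \<Omega>" and t: "t \<in> {0..T}"
  shows "christoffel W (g t) y = \<Gamma> (y, t)"
proof (rule christoffel_eqI)
  have g: "g t y = G (y, t)" if "(y, t) \<in> \<Omega>" for y
    using extends[OF that] t by simp
  show "bilinear (g t y)" "\<And>u v. g t y u v = g t y v u" "\<And>z. (\<And>w. g t y z w = 0) \<Longrightarrow> z = 0"
    unfolding g[OF p] using bilinear_metric[OF p] metric_sym[OF p] nondegenerate[OF p] by blast+
  show "bilinear (\<Gamma> (y, t))" "\<Gamma> (y, t) u v = \<Gamma> (y, t) v u" for u v
    using bilinear_connection[OF p] torsion_free[OF p] by blast+
  fix u v w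
  have "dderiv W (\<lambda>q. g t q v w) y u = dird (u, 0) (\<lambda>p. G p v w) (y, t)"
    by (rule horizontal_dderiv_eqI[OF p t differentiable_metric[OF p]]) (simp add: g)
  then show "dderiv W (\<lambda>q. g t q v w) y u = g t y (\<Gamma> (y, t) u v) w + g t y v (\<Gamma> (y, t) u w)"
    by (simp add: compatible[OF p] g[OF p])
qed

lemma product_metric_eq:
  "p \<in> \<Omega> \<Longrightarrow> snd p \<in> {0..T} \<Longrightarrow> product_metric g p U V = G p (fst U) (fst V) + snd U * snd V"
  by (simp add: product_metric_def extends)

text \<open>Verifies torsion and compatibility for \<open>\<Gamma>hat\<close> and concludes by
  uniqueness. The two \<open>P\<close> terms with factor \<open>snd U\<close> add up to the time
  derivative of the metric; the other \<open>P\<close> terms cancel against the vertical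
  parts.\<close>

lemma christoffel_product:
  assumes p: "p \<in> \<Omega>" "snd p \<in> {0..T}"
  shows "christoffel (W \<times> {0..T}) (product_metric g) p = \<Gamma>hat p"
proof (rule christoffel_eqI)
  note bil = bilinear_metric[OF p(1)] and pm = product_metric_eq[OF p]
  note lin = bilinear_ladd[OF bil] bilinear_lmul[OF bil] bilinear_radd[OF bil] bilinear_rmul[OF bil]
  show "bilinear (product_metric g p)"
    unfolding bilinear_def by (intro conjI allI linearI) (simp_all add: pm lin algebra_simps)
  show "product_metric g p U V = product_metric g p V U" for U V
    by (simp add: pm metric_sym[OF p(1), of "fst U"])
  show "Z = 0" if "\<And>V. product_metric g p Z V = 0" for Z
  proof -
    have "G p (fst Z) w = 0" for w
      using that[of "(w, 0)"] by (simp add: pm)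
    moreover have "snd Z = 0"
      using that[of "(0, 1)"] by (simp add: pm bilinear_rzero[OF bil])
    ultimately show ?thesis using nondegenerate[OF p(1)] by (simp add: prod_eq_iff)
  qed
  show "bilinear (\<Gamma>hat p)" by (rule bilinear_\<Gamma>hat[OF p(1)])
  show "\<Gamma>hat p U V = \<Gamma>hat p V U" for U V
    by (simp add: \<Gamma>hat_def torsion_free[OF p(1), of "fst U"] metric_dt_sym[OF p(1), of "fst U"] add.commute)
  fix U V V' :: "'a \<times> real"
  have diff: "(\<lambda>p. G p (fst V) (fst V')) differentiable at p"
    by (rule differentiable_metric[OF p(1)])
  have "dderiv (W \<times> {0..T}) (\<lambda>q. product_metric g q V V') p U
      = dird U (\<lambda>p. G p (fst V) (fst V') + snd V * snd V') p"
    by (rule slab_dderiv_eqI[OF p]) (use diff in \<open>auto simp: product_metric_eq\<close>)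
  also have "\<dots> = dird U (\<lambda>p. G p (fst V) (fst V')) p"
    by (subst dird_add) (use diff in \<open>simp_all add: dird_const\<close>)
  also have "\<dots> = dird (fst U, 0) (\<lambda>p. G p (fst V) (fst V')) p
      + snd U * metric_dt p (fst V) (fst V')"
    using linear_add[OF linear_dird[OF diff], of "(fst U, 0)" "snd U *\<^sub>R (0, 1)"]
      linear_scale[OF linear_dird[OF diff], of "snd U" "(0, 1)"]
    by (simp add: metric_dt_def)
  also have "\<dots> = product_metric g p (\<Gamma>hat p U V) V' + product_metric g p V (\<Gamma>hat p U V')"
    using metric_sym[OF p(1), of "fst V" "P p _"] metric_dt_sym[OF p(1), of "fst V'" "fst V"]
    by (simp add: pm \<Gamma>hat_def compatible[OF p(1)] lin metric_P[OF p(1)] field_simps)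
  finally show "dderiv (W \<times> {0..T}) (\<lambda>q. product_metric g q V V') p U
     = product_metric g p (\<Gamma>hat p U V) V' + product_metric g p V (\<Gamma>hat p U V')" .
qed

text \<open>Constant fields have vanishing derivatives and brackets, so only derivatives and
  compositions of \<open>\<Gamma>hat\<close> survive.\<close>

lemma curv_op_product:
  assumes p: "p \<in> \<Omega>" "snd p \<in> {0..T}"
  shows "curv_op (W \<times> {0..T}) (product_metric g) (\<lambda>_. a) (\<lambda>_. b) (\<lambda>_. d) p =
    dird a (\<lambda>q. \<Gamma>hat q b d) p + \<Gamma>hat p a (\<Gamma>hat p b d)
    - (dird b (\<lambda>q. \<Gamma>hat q a d) p + \<Gamma>hat p b (\<Gamma>hat p a d))"
proof -
  have const: "dderiv (W \<times> {0..T}) (\<lambda>_. c) q v = 0" if "q \<in> \<Omega>" "snd q \<in> {0..T}" for c q v :: "'a \<times> real"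
    using slab_dderiv_eqI[OF that, of "\<lambda>_. c" "\<lambda>_. c"] by (simp add: dird_const)
  have cov: "cov_deriv (W \<times> {0..T}) (product_metric g) (\<lambda>_. b) (\<lambda>_. d) q = \<Gamma>hat q b d"
    if "q \<in> \<Omega>" "snd q \<in> {0..T}" for b d q
    by (simp add: cov_deriv_def const[OF that] christoffel_product[OF that])
  have cov2: "cov_deriv (W \<times> {0..T}) (product_metric g) (\<lambda>_. a)
      (cov_deriv (W \<times> {0..T}) (product_metric g) (\<lambda>_. b) (\<lambda>_. d)) p
     = dird a (\<lambda>q. \<Gamma>hat q b d) p + \<Gamma>hat p a (\<Gamma>hat p b d)" for a b d
    unfolding cov_deriv_def[of _ _ "\<lambda>_. a"] cov[OF p] christoffel_product[OF p]
    using slab_dderiv_eqI[OF p Cinf_on_differentiable[OF Cinf_\<Gamma>hat p(1)] cov] by simp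
  have "lie_bracket (W \<times> {0..T}) (\<lambda>_. a) (\<lambda>_. b) p = 0"
    by (simp add: lie_bracket_def const[OF p])
  then have "cov_deriv (W \<times> {0..T}) (product_metric g) (lie_bracket (W \<times> {0..T}) (\<lambda>_. a) (\<lambda>_. b)) (\<lambda>_. d) p = 0"
    by (simp add: cov_deriv_def const[OF p] christoffel_product[OF p] bilinear_lzero[OF bilinear_\<Gamma>hat[OF p(1)]])
  then show ?thesis by (simp add: curv_op_def cov2)
qed

text \<open>The quadratic terms in \<open>metric_dt\<close> are those of the Gauss equation. The
  last term is half the covariant derivative of \<open>metric_dt\<close>; together with the time
  derivative of \<open>\<Gamma>\<close> inside \<open>curv\<close> it forms the Codazzi
  part.\<close>

lemma Rm_product:
  assumes p: "p \<in> \<Omega>" "snd p \<in> {0..T}"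
  shows "Rm (W \<times> {0..T}) (product_metric g) p (H, 1) (hor S) (hor H) (hor S) =
    G p (curv p H S S) H - metric_dt p S S * metric_dt p H H / 4 + (metric_dt p S H)\<^sup>2 / 4
    - (dird (S, 0) (\<lambda>p. metric_dt p S H) p - metric_dt p (\<Gamma> p S S) H - metric_dt p S (\<Gamma> p S H)) / 2"
proof -
  note bil = bilinear_metric[OF p(1)]
  have fst: "fst (dird v (\<lambda>q. \<Gamma>hat q a b) p) = dird v (\<lambda>q. fst (\<Gamma>hat q a b)) p" for v a b
    by (rule dird_bounded_linear[OF bounded_linear_fst Cinf_on_differentiable[OF Cinf_\<Gamma>hat p(1)], symmetric])
  have diff: "(\<lambda>q. P q S) differentiable at p" "(\<lambda>q. metric_dt q S H) differentiable at p"
    using Cinf_on_differentiable[OF Cinf_P p(1)] Cinf_bilinear_metric_dt Cinf_on_differentiable p(1)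
    unfolding Cinf_bilinear_def by blast+
  \<comment> \<open>The result is paired with the horizontal vector \<open>hor H\<close>, so the
    vertical component of the curvature is irrelevant.\<close>
  have curvature: "fst (curv_op (W \<times> {0..T}) (product_metric g) (\<lambda>_. (H, 1)) (\<lambda>_. hor S) (\<lambda>_. hor S) p) =
    curv p H S S + (- metric_dt p S S / 2) *\<^sub>R P p H + P p (\<Gamma> p S S)
    - (dird (S, 0) (\<lambda>p. P p S) p + \<Gamma> p S (P p S)) + (metric_dt p H S / 2) *\<^sub>R P p S"
    unfolding curv_op_product[OF p] fst_diff fst_add fst
    by (simp add: hor_def \<Gamma>hat_def curv_def dird_add differentiable_connection[OF p(1)] diff
        bilinear_radd[OF bilinear_connection[OF p(1)]])
  \<comment> \<open>The derivative of \<open>P\<close> is found by differentiating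
    \<open>metric_P\<close> rather than from the formula for \<open>P\<close>.\<close>
  have "dird (S, 0) (\<lambda>p. metric_dt p S H) p / 2 = dird (S, 0) (\<lambda>p. metric_dt p S H / 2) p"
    by (rule dird_bounded_linear[OF bounded_linear_divide diff(2), symmetric])
  also have "\<dots> = dird (S, 0) (\<lambda>p. G p (P p S) H) p"
    by (rule dird_cong[OF open_dom p(1)]) (simp add: metric_P)
  also have "\<dots> = dird (S, 0) (\<lambda>q. G q (P p S) H) p + G p (dird (S, 0) (\<lambda>p. P p S) p) H"
    using dird_bilinear_field[OF metric open_dom open_dom Cinf_on_ident _ Cinf_P Cinf_on_const p(1),
        of "(S, 0)" S H]
    by (simp add: dirdI[OF has_derivative_ident] dird_const bilinear_rzero[OF bil])
  finally have "G p (dird (S, 0) (\<lambda>p. P p S) p) H + G p (\<Gamma> p S (P p S)) H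
     = dird (S, 0) (\<lambda>p. metric_dt p S H) p / 2 - metric_dt p S (\<Gamma> p S H) / 2"
    by (simp add: compatible[OF p(1)] metric_P[OF p(1)] add_divide_distrib)
  then show ?thesis
    unfolding Rm_def product_metric_eq[OF p] curvature
    using metric_dt_sym[OF p(1), of H S]
    by (simp add: hor_def bilinear_ladd[OF bil] bilinear_lsub[OF bil] bilinear_lmul[OF bil]
        bilinear_lneg[OF bil] metric_P[OF p(1)] power2_eq_square field_simps)
qed

end

section \<open>The Ricci tensor as time derivative of the extended metric\<close>

locale slab_ricci_flow = slab_metric +
  assumes ricci_flow: "t \<in> {0..T} \<Longrightarrow> y \<in> W \<Longrightarrow>
    ((\<lambda>\<tau>. g \<tau> y u v) has_real_derivative - 2 * Ric W (g t) y u v) (at t within {0..T})"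
begin

text \<open>Within \<open>{0..T}\<close> the extension has the same time derivative as
  \<open>g\<close>, and this derivative is unique even at the end points because
  \<open>0 < T\<close>.\<close>

lemma Ric_eq:
  assumes p: "(y, t) \<in> \<Omega>" and t: "t \<in> {0..T}"
  shows "Ric W (g t) y u v = - metric_dt (y, t) u v / 2"
proof -
  have "((\<lambda>\<tau>. G (y, \<tau>) u v) has_vector_derivative metric_dt (y, t) u v) (at t)"
    using dird_line[of "\<lambda>p. G p u v" "(y, 0)" t "(0, 1)"] differentiable_metric[OF p]
    by (simp add: metric_dt_def)
  then have 1: "((\<lambda>\<tau>. G (y, \<tau>) u v) has_vector_derivative metric_dt (y, t) u v) (at t within {0..T})"
    by (rule has_vector_derivative_at_within)
  have "open ((\<lambda>\<tau>. (y, \<tau>)) -` \<Omega>)"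
    by (intro open_vimage open_dom continuous_intros)
  then obtain e where "e > 0" and e: "\<And>\<tau>. dist \<tau> t < e \<Longrightarrow> (y, \<tau>) \<in> \<Omega>"
    using p by (auto simp: open_dist)
  have "((\<lambda>\<tau>. g \<tau> y u v) has_vector_derivative metric_dt (y, t) u v) (at t within {0..T})"
    by (rule has_vector_derivative_transform_within[OF 1 \<open>e > 0\<close> t]) (use extends[OF e] in force)
  then have "- 2 * Ric W (g t) y u v = metric_dt (y, t) u v"
    using ricci_flow[OF t, of y u v] dom_subset[OF p] T_pos t
    by (intro vector_derivative_unique_within_closed_interval[of 0 T t "\<lambda>\<tau>. g \<tau> y u v"])
       (auto simp: has_real_derivative_iff_has_vector_derivative)
  then show ?thesis by simp
qed

text \<open>\<open>Ric_eq\<close> holds at all points of the slice in \<open>\<Omega>\<close>, so it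
  may be differentiated horizontally. The outcome is exactly the last term of
  \<open>Rm_product\<close>.\<close>

lemma cov_deriv2_Ric:
  assumes p: "(y, t) \<in> \<Omega>" and t: "t \<in> {0..T}"
  shows "cov_deriv2 W (g t) (Ric W (g t)) y S S H =
    - (dird (S, 0) (\<lambda>p. metric_dt p S H) (y, t) - metric_dt (y, t) (\<Gamma> (y, t) S S) H
       - metric_dt (y, t) S (\<Gamma> (y, t) S H)) / 2"
proof -
  have diff: "(\<lambda>p. metric_dt p S H) differentiable at (y, t)"
    using Cinf_bilinear_metric_dt Cinf_on_differentiable p unfolding Cinf_bilinear_def by blast
  have bl: "bounded_linear (\<lambda>x::real. - x / 2)"
    using bounded_linear_minus[OF bounded_linear_divide[of 2]] by simp
  have "dderiv W (\<lambda>y. Ric W (g t) y S H) y S = dird (S, 0) (\<lambda>p. - metric_dt p S H / 2) (y, t)"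
    by (rule horizontal_dderiv_eqI[OF p t differentiableI[OF bounded_linear.has_derivative[OF bl has_derivative_dird[OF diff]]]])
       (rule Ric_eq[OF _ t])
  also have "\<dots> = - dird (S, 0) (\<lambda>p. metric_dt p S H) (y, t) / 2"
    by (rule dird_bounded_linear[OF bl diff])
  finally show ?thesis
    by (simp add: cov_deriv2_def christoffel_slice[OF p t] Ric_eq[OF p t] field_simps)
qed

end


section \<open>Curve shrinking in the coordinates of a chart\<close>

text \<open>Links the curve \<open>\<gamma>\<close> to its extension \<open>Y\<close>. The condition
  \<open>nonneg\<close> lets the square of \<open>k\<close>, which is defined by a square root, be
  replaced by the inner product.\<close>

locale shrinking_curve =
  slab_ricci_flow \<Omega> G R W T g + moving_curve \<Omega> G "raised_metric.\<Gamma> G R" N Y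
  for \<Omega> :: "('a::euclidean_space \<times> real) set" and G R W T g N Y +
  fixes \<gamma> :: "real \<Rightarrow> real \<Rightarrow> 'a"
  assumes curve_eq: "(x, t) \<in> N \<Longrightarrow> t \<in> {0..T} \<Longrightarrow> \<gamma> x t = Y (x, t)"
    and shrinking: "(x, t) \<in> N \<Longrightarrow> t \<in> {0..T} \<Longrightarrow>
      ((\<lambda>\<tau>. \<gamma> x \<tau>) has_vector_derivative curvature_vector W g \<gamma> x t) (at t within {0..T})"
    and nonneg: "t \<in> {0..T} \<Longrightarrow> y \<in> W \<Longrightarrow> 0 \<le> g t y u u"
begin

section \<open>The geometric quantities of \<open>\<gamma>\<close> in terms of smooth fields\<close>

lemma open_row: "open {\<xi>. (\<xi>, t) \<in> N}"
proof -
  have "open ((\<lambda>\<xi>. (\<xi>, t)) -` N)"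
    by (intro open_vimage open_N continuous_intros)
  then show ?thesis by (simp add: vimage_def)
qed

lemma row_derivative:
  assumes "(x, t) \<in> N" "f differentiable at (x, t)" "\<And>\<xi>. (\<xi>, t) \<in> N \<Longrightarrow> F \<xi> = f (\<xi>, t)"
  shows "(F has_vector_derivative dird (1, 0) f (x, t)) (at x)"
proof (rule has_vector_derivative_transform_within_open[OF _ open_row])
  show "((\<lambda>\<xi>. f (\<xi>, t)) has_vector_derivative dird (1, 0) f (x, t)) (at x)"
    using dird_line[of f "(0, t)" x "(1, 0)"] assms(2) by simp
qed (use assms in auto)

text \<open>Quantities of \<open>\<gamma>\<close> agree with the smooth fields only for times in
  \<open>{0..T}\<close>, so time derivatives transfer within this interval, unlike the two-sided
  derivatives in \<open>row_derivative\<close>.\<close>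

lemma column_derivative:
  assumes "(x, t) \<in> N" "t \<in> {0..T}" "f differentiable at (x, t)"
    and "\<And>\<tau>. (x, \<tau>) \<in> N \<Longrightarrow> \<tau> \<in> {0..T} \<Longrightarrow> F \<tau> = f (x, \<tau>)"
  shows "(F has_vector_derivative dird (0, 1) f (x, t)) (at t within {0..T})"
proof -
  have "open ((\<lambda>\<tau>. (x, \<tau>)) -` N)"
    by (intro open_vimage open_N continuous_intros)
  then obtain e where e: "e > 0" "\<And>\<tau>. dist \<tau> t < e \<Longrightarrow> (x, \<tau>) \<in> N"
    using assms(1) by (auto simp: open_dist)
  have "((\<lambda>\<tau>. f (x, \<tau>)) has_vector_derivative dird (0, 1) f (x, t)) (at t)"
    using dird_line[of f "(x, 0)" t "(0, 1)"] assms(3) by simp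
  then have d: "((\<lambda>\<tau>. f (x, \<tau>)) has_vector_derivative dird (0, 1) f (x, t)) (at t within {0..T})"
    by (rule has_vector_derivative_at_within)
  show ?thesis
    by (rule has_vector_derivative_transform_within[OF d e(1) assms(2)]) (use assms(4) e(2) in force)
qed

lemma column_vector_derivative:
  assumes "t \<in> {0..T}" "(F has_vector_derivative v) (at t within {0..T})"
  shows "vector_derivative F (at t within {0..T}) = v"
  using vector_derivative_within_cbox[of 0 T t F v] T_pos assms by (simp add: box_real)

context
  fixes x t
  assumes z: "(x, t) \<in> N" and t: "t \<in> {0..T}"
begin

lemma g_eq: "g t (Y (x, t)) = G (q (x, t))"
  using extends[OF q_in[OF z]] t by (simp add: q_def)

lemma q_eq: "q (x, t) = (\<gamma> x t, t)"
  by (simp add: q_def curve_eq[OF z t])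

lemma velocity: "((\<lambda>\<xi>. \<gamma> \<xi> t) has_vector_derivative X (x, t)) (at x)"
  unfolding X_def
  by (rule row_derivative[OF z Cinf_on_differentiable[OF smooth_Y z] curve_eq[OF _ t]])

lemma speed_eq: "speed g \<gamma> x t = \<sigma> (x, t)"
  using vector_derivative_at[OF velocity] by (simp add: speed_def Let_def \<sigma>_def ip_def curve_eq[OF z t] g_eq)

lemma unit_tangent_eq: "unit_tangent g \<gamma> x t = S (x, t)"
  using vector_derivative_at[OF velocity] by (simp add: unit_tangent_def S_def speed_eq)

end

lemma curvature_vector_eq:
  assumes z: "(x, t) \<in> N" and t: "t \<in> {0..T}"
  shows "curvature_vector W g \<gamma> x t = H (x, t)"
proof -
  have "((\<lambda>\<xi>. unit_tangent g \<gamma> \<xi> t) has_vector_derivative dird (1, 0) S (x, t)) (at x)"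
    by (rule row_derivative[OF z Cinf_on_differentiable[OF Cinf_S z] unit_tangent_eq[OF _ t]])
  then show ?thesis
    using q_in[OF z]
    by (simp add: curvature_vector_def cov_along_def H_def Dx_def speed_eq[OF z t] unit_tangent_eq[OF z t]
        vector_derivative_at vector_derivative_at[OF velocity[OF z t]] q_eq[OF z t] christoffel_slice[OF _ t])
qed

text \<open>Both sides are the derivative of \<open>\<gamma>\<close> in time within
  \<open>{0..T}\<close>, which is unique.\<close>

lemma E_eq:
  assumes z: "(x, t) \<in> N" and t: "t \<in> {0..T}"
  shows "E (x, t) = H (x, t)"
proof -
  have "((\<lambda>\<tau>. \<gamma> x \<tau>) has_vector_derivative E (x, t)) (at t within {0..T})"
    unfolding E_def
    by (rule column_derivative[OF z t Cinf_on_differentiable[OF smooth_Y z] curve_eq])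
  then show ?thesis
    using column_vector_derivative[OF t] shrinking[OF z t] curvature_vector_eq[OF z t] by metis
qed

context
  fixes x t
  assumes z: "(x, t) \<in> N" and t: "t \<in> {0..T}"
begin

lemma in_region: "(\<gamma> x t, t) \<in> \<Omega>"
  using q_in[OF z] by (simp add: q_eq[OF z t])

lemma field_X_eq: "field_X \<gamma> x t = (X (x, t), 0)"
  unfolding field_X_def graph_map_def
  by (intro vector_derivative_at has_vector_derivative_Pair velocity[OF z t] has_vector_derivative_const)

lemma field_Hhat_eq: "field_Hhat T \<gamma> x t = (H (x, t), 1)"
  unfolding field_Hhat_def graph_map_def
  by (intro column_vector_derivative[OF t] has_vector_derivative_Pair has_vector_derivative_id)
     (use shrinking[OF z t] curvature_vector_eq[OF z t] in simp)

lemma product_metric_graph: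
  "product_metric g (graph_map \<gamma> x t) U V = G (q (x, t)) (fst U) (fst V) + snd U * snd V"
  using product_metric_eq[OF in_region] t by (simp add: graph_map_def q_eq[OF z t])

lemma norm_X_eq:
  "sqrt (product_metric g (graph_map \<gamma> x t) (field_X \<gamma> x t) (field_X \<gamma> x t)) = \<sigma> (x, t)"
  by (simp add: product_metric_graph field_X_eq \<sigma>_def ip_def)

lemma curvature_eq:
  "sqrt (g t (\<gamma> x t) (curvature_vector W g \<gamma> x t) (curvature_vector W g \<gamma> x t)) = sqrt (ip H H (x, t))"
  by (simp add: curvature_vector_eq[OF z t] ip_def curve_eq[OF z t] g_eq[OF z t])

lemma curvature_square_eq:
  "(sqrt (g t (\<gamma> x t) (curvature_vector W g \<gamma> x t) (curvature_vector W g \<gamma> x t)))\<^sup>2 = ip H H (x, t)"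
  using nonneg[OF t, of "\<gamma> x t"] dom_subset[OF in_region]
  by (simp add: curvature_vector_eq[OF z t] ip_def curve_eq[OF z t] g_eq[OF z t])

text \<open>The vertical component comes from \<open>\<Gamma>hat\<close>. Its square will cancel the
  square of \<open>metric_dt\<close> on \<open>S\<close> and \<open>H\<close> in
  \<open>Rm_product\<close>.\<close>

lemma cov_along_H_eq:
  "cov_along (W \<times> {0..T}) (product_metric g) (\<lambda>\<xi>. graph_map \<gamma> \<xi> t) (\<lambda>\<xi>. hor (curvature_vector W g \<gamma> \<xi> t)) x
     /\<^sub>R \<sigma> (x, t) = (NH (x, t), - metric_dt (q (x, t)) (S (x, t)) (H (x, t)) / 2)"
proof -
  have "((\<lambda>\<xi>. hor (curvature_vector W g \<gamma> \<xi> t)) has_vector_derivative (dird (1, 0) H (x, t), 0)) (at x)"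
    unfolding hor_def
    by (intro has_vector_derivative_Pair has_vector_derivative_const
        row_derivative[OF z Cinf_on_differentiable[OF Cinf_H z] curvature_vector_eq[OF _ t]])
  note H' = vector_derivative_at[OF this]
  have X: "vector_derivative (\<lambda>\<xi>. graph_map \<gamma> \<xi> t) (at x) = (X (x, t), 0)"
    using field_X_eq by (simp only: field_X_def)
  have ch: "christoffel (W \<times> {0..T}) (product_metric g) (graph_map \<gamma> x t) = \<Gamma>hat (q (x, t))"
    using christoffel_product[OF in_region] t by (simp add: graph_map_def q_eq[OF z t])
  have "metric_dt (q (x, t)) (X (x, t)) (H (x, t)) = \<sigma> (x, t) * metric_dt (q (x, t)) (S (x, t)) (H (x, t))"
    using bilinear_lmul[OF bilinear_metric_dt[OF q_in[OF z]]] by (simp add: X_eq[OF z])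
  then show ?thesis
    unfolding cov_along_def H' X ch curvature_vector_eq[OF z t]
    using \<sigma>_pos[OF z] by (simp add: \<Gamma>hat_def hor_def NH_def Dx_def scaleR_add_right)
qed

text \<open>By \<open>ip_NHS\<close> the tangential part of \<open>NH\<close> is
  \<open>- ip H H\<close> times \<open>S\<close>; its removal lowers the square by the fourth power
  of the curvature. The vertical component \<open>h\<close> is orthogonal to
  \<open>X\<close>.\<close>

lemma perp_square:
  fixes h defines "V \<equiv> perp (product_metric g (graph_map \<gamma> x t)) (field_X \<gamma> x t) (NH (x, t), h)"
  shows "product_metric g (graph_map \<gamma> x t) V V = ip NH NH (x, t) - (ip H H (x, t))\<^sup>2 + h\<^sup>2"
proof -
  note bil = bilinear_metric[OF q_in[OF z]]
  have "V = (NH (x, t) + ip H H (x, t) *\<^sub>R S (x, t), h)"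
  proof -
    have "G (q (x, t)) (NH (x, t)) (X (x, t)) = - \<sigma> (x, t) * ip H H (x, t)"
      using ip_NHS[OF z] by (simp add: X_eq[OF z] bilinear_rmul[OF bil] ip_def)
    moreover have "G (q (x, t)) (X (x, t)) (X (x, t)) = \<sigma> (x, t) * \<sigma> (x, t)"
      using \<sigma>_square[OF z] by (simp add: ip_def)
    ultimately show ?thesis
      using \<sigma>_pos[OF z] by (simp add: V_def perp_def product_metric_graph field_X_eq X_eq[OF z])
  qed
  then show ?thesis
    using ip_NHS[OF z] ip_SS[OF z] ip_commute[OF z, of S NH]
    by (simp add: product_metric_graph bilinear_ladd[OF bil] bilinear_radd[OF bil] bilinear_lmul[OF bil]
        bilinear_rmul[OF bil] ip_def power2_eq_square algebra_simps)
qed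

end

theorem curvature_evolution:
  assumes z: "(x, t) \<in> N" and t: "t \<in> {0..T}"
  shows "let What = W \<times> {0..T}; Ghat = product_metric g;
       p = \<gamma> x t; phat = graph_map \<gamma> x t;
       X = field_X \<gamma>; Hhat = field_Hhat T \<gamma>;
       normX = (\<lambda>x t. sqrt (Ghat (graph_map \<gamma> x t) (X x t) (X x t)));
       S = unit_tangent g \<gamma>; H = curvature_vector W g \<gamma>;
       k = (\<lambda>x t. sqrt (g t (\<gamma> x t) (H x t) (H x t)));
       ds = (\<lambda>f x. deriv f x / normX x t);
       NSH = (cov_along What Ghat (\<lambda>\<xi>. graph_map \<gamma> \<xi> t) (\<lambda>\<xi>. hor (H \<xi> t)) x) /\<^sub>R normX x t;
       NSHperp = perp (Ghat phat) (X x t) NSH;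
       Rc = Ric W (g t)
   in ((\<lambda>\<tau>. (k x \<tau>)\<^sup>2) has_real_derivative
         ds (ds (\<lambda>\<xi>. (k \<xi> t)\<^sup>2)) x - 2 * Ghat phat NSHperp NSHperp + 2 * (k x t) ^ 4
         - 2 * Rc p (H x t) (H x t) + 4 * (k x t)\<^sup>2 * Rc p (S x t) (S x t)
         + 2 * Rm What Ghat phat (Hhat x t) (hor (S x t)) (hor (H x t)) (hor (S x t))
         + 2 * Rc p (S x t) (S x t) * Rc p (H x t) (H x t)
         - 2 * cov_deriv2 W (g t) Rc p (S x t) (S x t) (H x t))
       (at t within {0..T})"
proof -
  let ?k2 = "\<lambda>x t. (sqrt (g t (\<gamma> x t) (curvature_vector W g \<gamma> x t) (curvature_vector W g \<gamma> x t)))\<^sup>2"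
  let ?normX = "\<lambda>x t. sqrt (product_metric g (graph_map \<gamma> x t) (field_X \<gamma> x t) (field_X \<gamma> x t))"
  note kk = Cinf_on_dird[OF Cinf_ip[OF Cinf_H Cinf_H]]
  \<comment> \<open>Stated for every point of the row, since this derivative is itself
    differentiated in \<open>dd\<close>.\<close>
  have deriv: "deriv (\<lambda>\<xi>. ?k2 \<xi> t) \<xi> = dird (1, 0) (ip H H) (\<xi>, t)" if "(\<xi>, t) \<in> N" for \<xi>
    using row_derivative[OF that Cinf_on_differentiable[OF Cinf_ip[OF Cinf_H Cinf_H] that]
        curvature_square_eq[OF _ t]]
    by (intro DERIV_imp_deriv) (simp add: has_real_derivative_iff_has_vector_derivative)
  have "Cinf_on N (\<lambda>z. dird (1, 0) (ip H H) z / \<sigma> z)"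
    using Cinf_on_mult[OF open_N kk Cinf_inverse_\<sigma>] by (simp add: divide_inverse)
  then have dd: "deriv (\<lambda>\<xi>. deriv (\<lambda>\<xi>. ?k2 \<xi> t) \<xi> / ?normX \<xi> t) x
      = dird (1, 0) (\<lambda>z. dird (1, 0) (ip H H) z / \<sigma> z) (x, t)"
    using row_derivative[OF z Cinf_on_differentiable[OF _ z],
        of "\<lambda>z. dird (1, 0) (ip H H) z / \<sigma> z" "\<lambda>\<xi>. deriv (\<lambda>\<xi>. ?k2 \<xi> t) \<xi> / ?normX \<xi> t"]
      norm_X_eq[OF _ t] deriv
    by (intro DERIV_imp_deriv) (simp add: has_real_derivative_iff_has_vector_derivative)
  have k2: "((\<lambda>\<tau>. ?k2 x \<tau>) has_real_derivative dird (0, 1) (ip H H) (x, t)) (at t within {0..T})"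
    unfolding has_real_derivative_iff_has_vector_derivative
    by (rule column_derivative[OF z t Cinf_on_differentiable[OF Cinf_ip[OF Cinf_H Cinf_H] z] curvature_square_eq])
  have k4: "(sqrt (ip H H (x, t))) ^ 4 = (ip H H (x, t))\<^sup>2"
  proof -
    have "(sqrt (ip H H (x, t)))\<^sup>2 = ip H H (x, t)"
      using curvature_square_eq[OF z t] curvature_eq[OF z t] by simp
    then have "((sqrt (ip H H (x, t)))\<^sup>2)\<^sup>2 = (ip H H (x, t))\<^sup>2" by simp
    then show ?thesis by (simp flip: power_mult)
  qed
  \<comment> \<open>The open set of parameters in \<open>dt_kk\<close> is the whole row of
    \<open>N\<close> at time \<open>t\<close>, on which \<open>E_eq\<close> provides the
    curve-shrinking equation.\<close>
  have evol: "dird (0, 1) (ip H H) (x, t) =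
      dird (1, 0) (\<lambda>z. dird (1, 0) (ip H H) z / \<sigma> z) (x, t) / \<sigma> (x, t)
     - 2 * ip NH NH (x, t) + 4 * (ip H H (x, t))\<^sup>2
     + metric_dt (q (x, t)) (H (x, t)) (H (x, t)) - 2 * ip H H (x, t) * metric_dt (q (x, t)) (S (x, t)) (S (x, t))
     + 2 * G (q (x, t)) (curv (q (x, t)) (H (x, t)) (S (x, t)) (S (x, t))) (H (x, t))"
    by (rule dt_kk[OF open_row[of t] _ _ _ refl]) (use z E_eq[OF _ t] in auto)
  note p = in_region[OF z t]
  have kk': "sqrt (g t (\<gamma> x t) (H (x, t)) (H (x, t))) = sqrt (ip H H (x, t))"
    using curvature_eq[OF z t] by (simp add: curvature_vector_eq[OF z t])
  have "(sqrt (ip H H (x, t)))\<^sup>2 = ip H H (x, t)"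
    using curvature_square_eq[OF z t] curvature_eq[OF z t] by simp
  moreover have "Rm (W \<times> {0..T}) (product_metric g) (graph_map \<gamma> x t) (H (x, t), 1) (hor (S (x, t)))
      (hor (H (x, t))) (hor (S (x, t))) =
    G (q (x, t)) (curv (q (x, t)) (H (x, t)) (S (x, t)) (S (x, t))) (H (x, t))
    - metric_dt (q (x, t)) (S (x, t)) (S (x, t)) * metric_dt (q (x, t)) (H (x, t)) (H (x, t)) / 4
    + (metric_dt (q (x, t)) (S (x, t)) (H (x, t)))\<^sup>2 / 4
    + cov_deriv2 W (g t) (Ric W (g t)) (\<gamma> x t) (S (x, t)) (S (x, t)) (H (x, t))"
    unfolding graph_map_def q_eq[OF z t]
    by (subst Rm_product[OF p]) (use t in \<open>simp_all add: cov_deriv2_Ric[OF p t] diff_divide_distrib\<close>)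
  \<comment> \<open>With \<open>metric_dt\<close> equal to \<open>- 2 Ric\<close>, the explicit
    Ricci product and derivative terms undo those in \<open>Rm\<close>, and
    \<open>perp_square\<close> accounts for half of the coefficient 4 of the quartic term.\<close>
  ultimately show ?thesis
    unfolding Let_def dd norm_X_eq[OF z t] cov_along_H_eq[OF z t] perp_square[OF z t] field_Hhat_eq[OF z t]
      unit_tangent_eq[OF z t]
    by (intro DERIV_cong[OF k2])
       (simp add: curvature_vector_eq[OF z t] kk' k4 evol Ric_eq[OF p t, folded q_eq[OF z t]]
         power_divide)
qed

end


section \<open>Smooth extensions near a point\<close>

lemma smooth_on_extension:
  assumes "smooth_on D f" "p \<in> D"
  obtains U h where "open U" "p \<in> U" "Cinf_on U h" "\<And>q. q \<in> U \<inter> D \<Longrightarrow> h q = f q"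
proof -
  obtain U h where "open U \<and> p \<in> U \<and> (\<forall>k. Ck_on k U h) \<and> (\<forall>q\<in>U \<inter> D. h q = f q)"
    using assms unfolding smooth_on_def by meson
  then show thesis using that[of U h] by (simp add: Cinf_on_def)
qed

section \<open>Smooth inverse metrics and extensions of the data\<close>

definition gram :: "(real ^ 'n \<Rightarrow> real ^ 'n \<Rightarrow> real) \<Rightarrow> real ^ 'n ^ 'n" where
  "gram B = (\<chi> i j. B (axis i 1) (axis j 1))"

text \<open>Written as a quotient of determinants so that smooth dependence on the matrix entries is
  visible.\<close>

definition cramer_solution :: "real ^ 'n ^ 'n \<Rightarrow> real ^ 'n \<Rightarrow> real ^ 'n" where
  "cramer_solution A a = (\<chi> k. det (\<chi> i j. if j = k then a $ i else A $ i $ j) / det A)"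

lemma cramer_solution_iff: "det A \<noteq> 0 \<Longrightarrow> A *v z = a \<longleftrightarrow> z = cramer_solution A a"
  by (simp add: cramer cramer_solution_def)

lemma gram_mult:
  assumes "bilinear B" shows "(gram B *v z) \<bullet> w = B w z"
proof -
  have "B w z = (\<Sum>i\<in>UNIV. \<Sum>j\<in>UNIV. w $ i * (z $ j * B (axis i 1) (axis j 1)))"
    by (subst bilinear_Basis[OF assms])
       (simp add: Basis_vec_def sum.UNION_disjoint inner_axis axis_eq_axis UNION_singleton_eq_range
         sum.reindex inj_on_def)
  then show ?thesis
    by (simp add: gram_def inner_vec_def matrix_vector_mult_def sum_distrib_left sum_distrib_right algebra_simps)
qed

lemma Cinf_on_det:
  fixes A :: "'a::real_normed_vector \<Rightarrow> real ^ 'n ^ 'n"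
  assumes "open U" "\<And>i j. Cinf_on U (\<lambda>p. A p $ i $ j)"
  shows "Cinf_on U (\<lambda>p. det (A p))"
  unfolding det_def
  by (intro Cinf_on_sum Cinf_on_mult Cinf_on_prod Cinf_on_const assms)

text \<open>Positivity at \<open>p\<close> makes the Gram matrix invertible there; its determinant
  then stays nonzero on a neighbourhood, where Cramer's rule inverts it smoothly.\<close>

lemma raised_metric_exists:
  fixes G :: "(real ^ 'n) \<times> real \<Rightarrow> real ^ 'n \<Rightarrow> real ^ 'n \<Rightarrow> real"
  assumes U: "open U" "p \<in> U" and G: "Cinf_bilinear U G"
    and sym: "\<And>q u v. q \<in> U \<Longrightarrow> G q u v = G q v u"
    and pos: "\<And>u. u \<noteq> 0 \<Longrightarrow> 0 < G p u u"
  obtains \<Omega> R where "\<Omega> \<subseteq> U" "p \<in> \<Omega>" "raised_metric \<Omega> G R"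
proof -
  define \<Omega> where "\<Omega> = {q \<in> U. det (gram (G q)) \<noteq> 0}"
  have entry: "Cinf_on U (\<lambda>q. gram (G q) $ i $ j)" for i j
    using G by (simp add: Cinf_bilinear_def gram_def)
  have det: "Cinf_on U (\<lambda>q. det (gram (G q)))"
    by (rule Cinf_on_det[OF U(1) entry])
  have "open (U \<inter> (\<lambda>q. det (gram (G q))) -` (- {0}))"
    by (rule continuous_open_preimage[OF Cinf_on_continuous_on[OF det] U(1)]) auto
  then have open_\<Omega>: "open \<Omega>"
    by (auto simp: \<Omega>_def Int_def vimage_def)
  have bil: "bilinear (G q)" if "q \<in> U" for q
    using G that by (simp add: Cinf_bilinear_def)
  have "z = 0" if "gram (G p) *v z = 0" for z
  proof (rule ccontr)
    assume "z \<noteq> 0"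
    then show False using gram_mult[OF bil[OF U(2)], of z z] that pos[of z] by simp
  qed
  then have "p \<in> \<Omega>"
    using U(2) by (auto simp: \<Omega>_def invertible_det_nz[symmetric] invertible_left_inverse matrix_left_invertible_ker)
  have sub: "\<Omega> \<subseteq> U" by (auto simp: \<Omega>_def)
  have "raised_metric \<Omega> G (\<lambda>q. cramer_solution (gram (G q)))"
  proof (rule raised_metric.intro)
    show "open \<Omega>" by fact
    show "Cinf_bilinear \<Omega> G"
      using G sub Cinf_on_subset unfolding Cinf_bilinear_def by blast
    show "G q u v = G q v u" if "q \<in> \<Omega>" for q u v using that sub sym by blast
    show "G q (cramer_solution (gram (G q)) a) w = a \<bullet> w" if "q \<in> \<Omega>" for q a w
    proof -
      have "G q (cramer_solution (gram (G q)) a) w = (gram (G q) *v cramer_solution (gram (G q)) a) \<bullet> w"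
        using that sub sym gram_mult[OF bil] by (metis subsetD)
      then show ?thesis using that cramer_solution_iff[of "gram (G q)" "cramer_solution (gram (G q)) a" a]
        by (simp add: \<Omega>_def)
    qed
    show "Cinf_on \<Omega> (\<lambda>q. cramer_solution (gram (G q)) a)" for a
    proof (rule Cinf_on_Basis[OF open_\<Omega>])
      fix e :: "real ^ 'n" assume "e \<in> Basis"
      then obtain k where k: "e = axis k 1" by (auto simp: Basis_vec_def)
      have "Cinf_on \<Omega> (\<lambda>q. (\<chi> i j. if j = k then a $ i else gram (G q) $ i $ j) $ i $ j)" for i j
        using Cinf_on_subset[OF entry sub] Cinf_on_const by (cases "j = k") auto
      then have "Cinf_on \<Omega> (\<lambda>q. det (\<chi> i j. if j = k then a $ i else gram (G q) $ i $ j) * inverse (det (gram (G q))))"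
        by (intro Cinf_on_mult Cinf_on_inverse open_\<Omega> Cinf_on_det Cinf_on_subset[OF det sub]) (auto simp: \<Omega>_def)
      then show "Cinf_on \<Omega> (\<lambda>q. cramer_solution (gram (G q)) a \<bullet> e)"
        by (simp add: k inner_axis cramer_solution_def divide_inverse)
    qed
  qed
  then show thesis using that sub \<open>p \<in> \<Omega>\<close> by blast
qed

text \<open>The finitely many components on the basis are extended separately and reassembled. The
  result is symmetrised because the extensions of components \<open>i j\<close> and
  \<open>j i\<close> need not agree off \<open>D\<close>.\<close>

lemma bilinear_extension:
  fixes g :: "'p::real_normed_vector \<Rightarrow> 'a::euclidean_space \<Rightarrow> 'a \<Rightarrow> real"
  assumes smooth: "\<And>u v. smooth_on D (\<lambda>p. g p u v)" and p: "p \<in> D"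
    and bil: "\<And>q. q \<in> D \<Longrightarrow> bilinear (g q)" and sym: "\<And>q u v. q \<in> D \<Longrightarrow> g q u v = g q v u"
  obtains U G where "open U" "p \<in> U" "Cinf_bilinear U G" "\<And>q u v. G q u v = G q v u"
    "\<And>q. q \<in> U \<inter> D \<Longrightarrow> g q = G q"
proof -
  have "\<exists>U h. open U \<and> p \<in> U \<and> Cinf_on U h \<and> (\<forall>q\<in>U \<inter> D. h q = g q i j)" for i j
    using smooth_on_extension[OF smooth p, of i j] by metis
  then obtain V h where V: "\<And>i j. open (V i j)" "\<And>i j. p \<in> V i j" "\<And>i j. Cinf_on (V i j) (h i j)"
    and h: "\<And>i j q. q \<in> V i j \<inter> D \<Longrightarrow> h i j q = g q i j"
    by metis
  define U where "U = (\<Inter>i\<in>Basis. \<Inter>j\<in>Basis. V i j)"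
  define B where "B q u v = (\<Sum>i\<in>Basis. \<Sum>j\<in>Basis. (u \<bullet> i) * ((v \<bullet> j) * h i j q))" for q u v
  define G where "G q u v = (B q u v + B q v u) * (1 / 2)" for q u v
  have "open U" unfolding U_def by (intro open_INT finite_Basis ballI V)
  have "Cinf_bilinear U G"
    unfolding Cinf_bilinear_def
  proof (intro conjI ballI allI)
    show "bilinear (G q)" for q
      unfolding bilinear_def G_def B_def
      by (intro conjI allI linearI)
         (simp_all add: inner_add_left algebra_simps sum.distrib sum_distrib_left add_divide_distrib)
    have "Cinf_on U (h i j)" if "i \<in> Basis" "j \<in> Basis" for i j
      by (rule Cinf_on_subset[OF V(3)[of i j]]) (use that in \<open>auto simp: U_def\<close>)
    then show "Cinf_on U (\<lambda>q. G q u v)" for u v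
      unfolding G_def B_def by (intro Cinf_on_add Cinf_on_sum Cinf_on_mult Cinf_on_const \<open>open U\<close>)
  qed
  moreover have "G q u v = G q v u" for q u v
    unfolding G_def by (simp add: add.commute)
  moreover have "g q = G q" if q: "q \<in> U \<inter> D" for q
  proof (intro ext)
    fix u v
    have "B q u v = g q u v" for u v
      unfolding B_def bilinear_Basis[OF bil, of q u v, OF IntD2[OF q]] real_scaleR_def
      by (intro sum.cong refl arg_cong2[where f = "(*)"] h) (use q in \<open>auto simp: U_def\<close>)
    then show "g q u v = G q u v" using sym[of q u v] q by (simp add: G_def)
  qed
  moreover have "p \<in> U" using V(2) by (simp add: U_def)
  ultimately show thesis using that \<open>open U\<close> by blast
qed

lemma ricci_flow_chart:
  fixes g :: "('m, 'n::finite) metric_family"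
  assumes flow: "ricci_flow \<A> T g" and "0 < T" and \<kappa>: "\<kappa> \<in> \<A>" and W: "open (chart_image \<kappa>)"
    and p: "y \<in> chart_image \<kappa>" "t \<in> {0..T}"
  obtains \<Omega> G R where "slab_ricci_flow \<Omega> G R (chart_image \<kappa>) T (g \<kappa>)" "(y, t) \<in> \<Omega>"
proof -
  let ?W = "chart_image \<kappa>"
  have fam: "riemannian_family \<A> T g" using flow by (simp add: ricci_flow_def)
  have g: "bilinear (g \<kappa> t y)" "g \<kappa> t y u v = g \<kappa> t y v u" "u \<noteq> 0 \<Longrightarrow> 0 < g \<kappa> t y u u"
    if "t \<in> {0..T}" "y \<in> ?W" for t y u v
    using fam \<kappa> that unfolding riemannian_family_def by blast+
  have smooth: "smooth_on (?W \<times> {0..T}) (\<lambda>p. g \<kappa> (snd p) (fst p) u v)" for u v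
    using fam \<kappa> unfolding riemannian_family_def by (simp add: split_def)
  obtain U G where U: "open U" "(y, t) \<in> U" "Cinf_bilinear U G" "\<And>q u v. G q u v = G q v u"
    and ext: "\<And>q. q \<in> U \<inter> ?W \<times> {0..T} \<Longrightarrow> g \<kappa> (snd q) (fst q) = G q"
  proof (rule bilinear_extension[where g = "\<lambda>p. g \<kappa> (snd p) (fst p)", OF smooth])
    show "(y, t) \<in> ?W \<times> {0..T}" using p by simp
  qed (use g in auto)
  \<comment> \<open>The restriction keeps all base points in the chart image, also at times outside
    the flow.\<close>
  have U': "open (U \<inter> ?W \<times> UNIV)" "(y, t) \<in> U \<inter> ?W \<times> UNIV"
    using U W p by (auto intro: open_Times)
  have G': "Cinf_bilinear (U \<inter> ?W \<times> UNIV) G"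
    using U(3) Cinf_on_subset[OF _ Int_lower1] unfolding Cinf_bilinear_def by blast
  have "0 < G (y, t) u u" if "u \<noteq> 0" for u
    using g(3)[OF p(2,1) that] ext[of "(y, t)"] U(2) p by simp
  then obtain \<Omega> R where \<Omega>: "\<Omega> \<subseteq> U \<inter> ?W \<times> UNIV" "(y, t) \<in> \<Omega>" "raised_metric \<Omega> G R"
    using raised_metric_exists[OF U' G' U(4)] by metis
  interpret raised_metric \<Omega> G R by fact
  have "slab_ricci_flow \<Omega> G R ?W T (g \<kappa>)"
  proof
    show "open ?W" "0 < T" by fact+
    show "fst p \<in> ?W" if "p \<in> \<Omega>" for p using that \<Omega>(1) by auto
    show "g \<kappa> (snd p) (fst p) = G p" if "p \<in> \<Omega>" "snd p \<in> {0..T}" for p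
      using subsetD[OF \<Omega>(1) that(1)] that(2) ext[of p] by (simp add: mem_Times_iff)
    show "((\<lambda>\<tau>. g \<kappa> \<tau> y u v) has_real_derivative - 2 * Ric ?W (g \<kappa> t) y u v) (at t within {0..T})"
      if "t \<in> {0..T}" "y \<in> ?W" for t y u v
      using flow \<kappa> that unfolding ricci_flow_def by blast
  qed
  then show thesis using that \<Omega>(2) by blast
qed

text \<open>Pulls a relatively open set of circle times interval back along \<open>cis\<close>,
  giving a genuine neighbourhood in the plane whose points with admissible times map into the chart
  domain.\<close>

lemma curve_domain_open:
  assumes c: "continuous_map (top_of_set (sphere 0 1 \<times> {0..T})) M (\<lambda>(z, t). c z t)"
    and A: "openin M A" and t: "t \<in> {0..T}" "c (cis x) t \<in> A"
  obtains V where "open V" "(x, t) \<in> V" "\<And>\<xi> \<tau>. (\<xi>, \<tau>) \<in> V \<Longrightarrow> \<tau> \<in> {0..T} \<Longrightarrow> c (cis \<xi>) \<tau> \<in> A"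
proof -
  have "openin (top_of_set (sphere 0 1 \<times> {0..T})) {p \<in> sphere 0 1 \<times> {0..T}. (\<lambda>(z, t). c z t) p \<in> A}"
    using openin_continuous_map_preimage[OF c A] by simp
  then obtain V where V: "open V"
    "{p \<in> sphere 0 1 \<times> {0..T}. (\<lambda>(z, t). c z t) p \<in> A} = sphere 0 1 \<times> {0..T} \<inter> V"
    unfolding openin_open by blast
  have mem: "c (cis \<xi>) \<tau> \<in> A \<longleftrightarrow> (cis \<xi>, \<tau>) \<in> V" if "\<tau> \<in> {0..T}" for \<xi> \<tau>
    using V(2)[unfolded set_eq_iff, rule_format, of "(cis \<xi>, \<tau>)"] that by simp
  have "open ((\<lambda>p. (cis (fst p), snd p)) -` V)"
    by (intro open_vimage V continuous_intros)
  then show thesis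
    by (rule that) (use mem t in auto)
qed

theorem lemma0p2:
  fixes M :: "'m topology"
    and \<A> :: "('m, 'n::finite) chart set"
    and T :: real
    and g :: "('m, 'n) metric_family"
    and c :: "complex \<Rightarrow> real \<Rightarrow> 'm"
    and \<kappa> :: "('m, 'n) chart"
    and x t :: real
  assumes "compact_manifold M \<A>"
    and "0 < T"
    and "ricci_flow \<A> T g"
    and "immersed_curve_family M \<A> T c"
    and "curve_shrinking \<A> T g c"
    and "\<kappa> \<in> \<A>" and "t \<in> {0..T}" and "c (cis x) t \<in> fst \<kappa>"
  shows
    "let W = chart_image \<kappa>; G = g \<kappa>; \<gamma> = in_chart \<kappa> c;
         What = W \<times> {0..T}; Ghat = product_metric G;
         p = \<gamma> x t; phat = graph_map \<gamma> x t;
         X = field_X \<gamma>; Hhat = field_Hhat T \<gamma>;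
         normX = (\<lambda>x t. sqrt (Ghat (graph_map \<gamma> x t) (X x t) (X x t)));
         S = unit_tangent G \<gamma>; H = curvature_vector W G \<gamma>;
         k = (\<lambda>x t. sqrt (G t (\<gamma> x t) (H x t) (H x t)));
         ds = (\<lambda>f x. deriv f x / normX x t);
         NSH = (cov_along What Ghat (\<lambda>\<xi>. graph_map \<gamma> \<xi> t) (\<lambda>\<xi>. hor (H \<xi> t)) x) /\<^sub>R normX x t;
         NSHperp = perp (Ghat phat) (X x t) NSH;
         Rc = Ric W (G t)
     in ((\<lambda>\<tau>. (k x \<tau>)\<^sup>2) has_real_derivative
           ds (ds (\<lambda>\<xi>. (k \<xi> t)\<^sup>2)) x - 2 * Ghat phat NSHperp NSHperp + 2 * (k x t) ^ 4
           - 2 * Rc p (H x t) (H x t) + 4 * (k x t)\<^sup>2 * Rc p (S x t) (S x t)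
           + 2 * Rm What Ghat phat (Hhat x t) (hor (S x t)) (hor (H x t)) (hor (S x t))
           + 2 * Rc p (S x t) (S x t) * Rc p (H x t) (H x t)
           - 2 * cov_deriv2 W (G t) Rc p (S x t) (S x t) (H x t))
         (at t within {0..T})"
proof -
  define \<gamma> where "\<gamma> = in_chart \<kappa> c"
  define D where "D = {(x, t). t \<in> {0..T} \<and> c (cis x) t \<in> fst \<kappa>}"
  have xt: "(x, t) \<in> D" using assms by (simp add: D_def)
  have chart: "openin M (fst \<kappa>)" "open (chart_image \<kappa>)"
    using assms(1,6) by (auto simp: compact_manifold_def smooth_atlas_def)
  have \<gamma>_in: "\<gamma> \<xi> \<tau> \<in> chart_image \<kappa>" if "(\<xi>, \<tau>) \<in> D" for \<xi> \<tau>
    using that by (auto simp: D_def \<gamma>_def in_chart_def chart_image_def)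
  obtain \<Omega> G R where flow: "slab_ricci_flow \<Omega> G R (chart_image \<kappa>) T (g \<kappa>)" and p: "(\<gamma> x t, t) \<in> \<Omega>"
    using ricci_flow_chart[OF assms(3,2,6) chart(2) \<gamma>_in[OF xt] assms(7)] .
  interpret slab_ricci_flow \<Omega> G R "chart_image \<kappa>" T "g \<kappa>" by (rule flow)
  have smooth: "smooth_on D (\<lambda>p. \<gamma> (fst p) (snd p))"
    using assms(4,6) by (auto simp: immersed_curve_family_def D_def \<gamma>_def split_def)
  obtain U Y where U: "open U" "(x, t) \<in> U" and Y: "Cinf_on U Y"
    and Y_eq: "\<And>q. q \<in> U \<inter> D \<Longrightarrow> Y q = \<gamma> (fst q) (snd q)"
    by (rule smooth_on_extension[OF smooth xt], rule that)
  obtain V where V: "open V" "(x, t) \<in> V"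
    "\<And>\<xi> \<tau>. (\<xi>, \<tau>) \<in> V \<Longrightarrow> \<tau> \<in> {0..T} \<Longrightarrow> c (cis \<xi>) \<tau> \<in> fst \<kappa>"
  proof (rule curve_domain_open[where c = c and x = x, OF _ chart(1) assms(7,8)])
    show "continuous_map (top_of_set (sphere 0 1 \<times> {0..T})) M (\<lambda>(z, t). c z t)"
      using assms(4) by (simp add: immersed_curve_family_def)
  qed (rule that)
  have in_D: "(\<xi>, \<tau>) \<in> D" if "(\<xi>, \<tau>) \<in> V" "\<tau> \<in> {0..T}" for \<xi> \<tau>
    using V(3) that by (simp add: D_def)
  define q where "q z = (Y z, snd z)" for z
  \<comment> \<open>First the graph of the extension is kept inside the domain of the extended
    metric.\<close>
  define N1 where "N1 = (U \<inter> V) \<inter> q -` \<Omega>"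
  have q: "Cinf_on (U \<inter> V) q"
    unfolding q_def[abs_def] using U V
    by (intro Cinf_on_Pair Cinf_on_subset[OF Y] Cinf_on_bounded_linear[OF bounded_linear_snd] Cinf_on_ident) auto
  have N1: "open N1"
    unfolding N1_def
    by (rule continuous_open_preimage[OF Cinf_on_continuous_on[OF q] _ open_dom]) (use U V in auto)
  have sub: "N1 \<subseteq> U" "N1 \<subseteq> U \<inter> V" by (auto simp: N1_def)
  define speed2 where "speed2 z = G (q z) (dird (1, 0) Y z) (dird (1, 0) Y z)" for z
  have speed2: "Cinf_on N1 speed2"
    unfolding speed2_def[abs_def]
    by (intro Cinf_on_bilinear_field[OF metric N1 Cinf_on_subset[OF q sub(2)]]
        Cinf_on_dird Cinf_on_subset[OF Y sub(1)]) (auto simp: N1_def)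
  \<comment> \<open>Then the extended speed is kept positive: outside \<open>{0..T}\<close> neither
    \<open>Y\<close> need be immersed nor \<open>G\<close> positive definite.\<close>
  define N where "N = N1 \<inter> speed2 -` {0<..}"
  have N: "open N"
    unfolding N_def by (rule continuous_open_preimage[OF Cinf_on_continuous_on[OF speed2] N1]) auto
  have N_sub: "N \<subseteq> U" "N \<subseteq> V" by (auto simp: N_def N1_def)
  have curve: "\<gamma> \<xi> \<tau> = Y (\<xi>, \<tau>)" if "(\<xi>, \<tau>) \<in> U \<inter> V" "\<tau> \<in> {0..T}" for \<xi> \<tau>
    using Y_eq[of "(\<xi>, \<tau>)"] in_D that by simp
  \<comment> \<open>At the given time \<open>Y\<close> agrees with \<open>\<gamma>\<close> on a
    neighbourhood in \<open>x\<close>, so its \<open>x\<close>-derivative is the nonzero velocity of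
    the given curve.\<close>
  have xt_N: "(x, t) \<in> N"
  proof -
    have row: "open ((\<lambda>\<xi>. (\<xi>, t)) -` (U \<inter> V))"
      using U V by (intro open_vimage continuous_intros) auto
    have "((\<lambda>\<xi>. Y (\<xi>, t)) has_vector_derivative dird (1, 0) Y (x, t)) (at x)"
      using dird_line[of Y "(0, t)" x "(1, 0)"] Cinf_on_differentiable[OF Y U(2)] by simp
    then have "((\<lambda>\<xi>. \<gamma> \<xi> t) has_vector_derivative dird (1, 0) Y (x, t)) (at x)"
      by (rule has_vector_derivative_transform_within_open[OF _ row]) (use U V curve assms(7) in auto)
    then have "dird (1, 0) Y (x, t) \<noteq> 0"
      using assms(4,6,7,8) by (auto simp: immersed_curve_family_def \<gamma>_def dest!: vector_derivative_at)
    moreover have "q (x, t) = (\<gamma> x t, t)"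
      using curve[of x t] U V assms(7) by (simp add: q_def)
    moreover have "g \<kappa> t (\<gamma> x t) = G (\<gamma> x t, t)"
      using extends[OF p] assms(7) by simp
    moreover have "0 < g \<kappa> t (\<gamma> x t) u u" if "u \<noteq> 0" for u
      using assms(3,6,7) \<gamma>_in[OF xt] that unfolding ricci_flow_def riemannian_family_def by blast
    ultimately show ?thesis
      using p U V by (simp add: N_def N1_def speed2_def)
  qed
  have "shrinking_curve \<Omega> G R (chart_image \<kappa>) T (g \<kappa>) N Y \<gamma>"
  proof
    show "open N" by fact
    show "Cinf_on N Y" by (rule Cinf_on_subset[OF Y N_sub(1)])
    show "(Y z, snd z) \<in> \<Omega>" if "z \<in> N" for z
      using that by (auto simp: N_def N1_def q_def)
    show "0 < G (Y z, snd z) (dird (1, 0) Y z) (dird (1, 0) Y z)" if "z \<in> N" for z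
      using that by (auto simp: N_def speed2_def q_def)
    show "\<gamma> \<xi> \<tau> = Y (\<xi>, \<tau>)" if "(\<xi>, \<tau>) \<in> N" "\<tau> \<in> {0..T}" for \<xi> \<tau>
      using curve that N_sub by blast
    show "((\<lambda>\<tau>. \<gamma> \<xi> \<tau>) has_vector_derivative curvature_vector (chart_image \<kappa>) (g \<kappa>) \<gamma> \<xi> \<tau>) (at \<tau> within {0..T})"
      if "(\<xi>, \<tau>) \<in> N" "\<tau> \<in> {0..T}" for \<xi> \<tau>
      using assms(5,6) V(3)[of \<xi> \<tau>] that N_sub unfolding curve_shrinking_def \<gamma>_def by blast
    show "0 \<le> g \<kappa> \<tau> y u u" if "\<tau> \<in> {0..T}" "y \<in> chart_image \<kappa>" for \<tau> y u
    proof (cases "u = 0")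
      case True
      then show ?thesis
        using assms(3,6) that bilinear_lzero unfolding ricci_flow_def riemannian_family_def
        by (metis order_refl)
    next
      case False
      then show ?thesis
        using assms(3,6) that unfolding ricci_flow_def riemannian_family_def by (meson less_imp_le)
    qed
  qed
  from shrinking_curve.curvature_evolution[OF this xt_N assms(7)] show ?thesis
    unfolding \<gamma>_def Let_def .
qed

end
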